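(* Let $\mathbb G$ be a Carnot group and $j\in\{1,\dots,n_1\}$. Then (1) $\mathrm{Pr}_j(\delta_rx)=\delta_r\mathrm{Pr}_j(x)$ for all $x\in\mathbb G$, $r>0$; (2) for all $x,y\in\mathbb G$, $\mathrm{Pr}_j(x\cdot y)=\mathrm{Pr}_j(x)\cdot\exp(x_jX_j)\cdot\mathrm{Pr}_j(y)\cdot\exp(-x_jX_j)$.
   Context: $\mathbb{G}$ is a Carnot group: Lie algebra $\mathfrak{g}=V_1\oplus\dots\oplus V_m$ of left-invariant vector fields with $[V_1,V_k]=V_{k+1}$ ($V_{m+1}=\{0\}$), $n_1=\dim V_1$; basis $X_1,\dots,X_N$ ordered by degree, each $V_k$ spanned by a subcollection, $\sigma_i=k$ if $X_i\in V_k$; points identified with canonical coordinates $(x_1,\dots,x_N)=\exp(\sum x_iX_i)(e)$; dilations $\delta_r(x)=(r^{\sigma_i}x_i)_i$. $\Pi_j=\{x:x_j=0\}$; every $x$ is uniquely $x=p\exp(x_jX_j)$ with $p\in\Pi_j$, and $\mathrm{Pr}_j(x):=p$. *)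

theory Defs
  imports "HOL-Analysis.Analysis"
begin

text \<open>The Lie algebra
  g = V_1 + ... + V_m is identified with real^'n via the basis X_i = axis i 1;
  sigma i is the degree of X_i; br is the Lie bracket in these coordinates.
  Since the coordinates are canonical of the first kind, exp is the identity and
  the group law is the Baker-Campbell-Hausdorff (Dynkin) series, which is a finite
  sum because the algebra is nilpotent of step m.\<close>

definition stratum :: "('n::finite \<Rightarrow> nat) \<Rightarrow> nat \<Rightarrow> (real^'n) set" where
  "stratum \<sigma> k = span {axis i 1 | i. \<sigma> i = k}"

definition carnot_step :: "('n::finite \<Rightarrow> nat) \<Rightarrow> nat" where
  "carnot_step \<sigma> = Max (range \<sigma>)"

definition stratified_lie_algebra ::
  "(real^'n \<Rightarrow> real^'n \<Rightarrow> real^'n) \<Rightarrow> ('n::finite \<Rightarrow> nat) \<Rightarrow> bool" where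
  "stratified_lie_algebra br \<sigma> \<longleftrightarrow>
     bilinear br \<and>
     (\<forall>x. br x x = 0) \<and>
     (\<forall>x y z. br x (br y z) + br y (br z x) + br z (br x y) = 0) \<and>
     (\<forall>i. 1 \<le> \<sigma> i) \<and>
     (\<forall>k\<ge>1. span {br u v | u v. u \<in> stratum \<sigma> 1 \<and> v \<in> stratum \<sigma> k}
              = stratum \<sigma> (k + 1))"

fun nested_bracket ::
  "(real^'n \<Rightarrow> real^'n \<Rightarrow> real^'n) \<Rightarrow> real^'n \<Rightarrow> real^'n \<Rightarrow> bool list \<Rightarrow> real^'n" where
  "nested_bracket br X Y [] = 0"
| "nested_bracket br X Y [a] = (if a then X else Y)"
| "nested_bracket br X Y (a # b # w) =
     br (if a then X else Y) (nested_bracket br X Y (b # w))"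

definition dynkin_word :: "(nat \<times> nat) list \<Rightarrow> bool list" where
  "dynkin_word rs = concat (map (\<lambda>(r, s). replicate r True @ replicate s False) rs)"

text \<open>Dynkin's form of the BCH series, truncated at order m (all omitted terms
  are brackets of length > m, hence vanish in a step-m nilpotent algebra).\<close>
definition bch ::
  "(real^'n \<Rightarrow> real^'n \<Rightarrow> real^'n) \<Rightarrow> nat \<Rightarrow> real^'n \<Rightarrow> real^'n \<Rightarrow> real^'n" where
  "bch br m X Y =
     (\<Sum>n\<in>{1..m}. ((-1) ^ (n - 1) / real n) *\<^sub>R
        (\<Sum>rs\<in>{rs. length rs = n \<and> set rs \<subseteq> ({0..m} \<times> {0..m}) - {(0, 0)}}.
           (1 / (real (sum_list (map (\<lambda>(r, s). r + s) rs)) *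
                 prod_list (map (\<lambda>(r, s). fact r * fact s) rs))) *\<^sub>R
           nested_bracket br X Y (dynkin_word rs)))"

text \<open>The group law x \<cdot> y = exp^{-1}(exp(x) exp(y)) in exponential coordinates.\<close>
definition carnot_mult ::
  "(real^'n \<Rightarrow> real^'n \<Rightarrow> real^'n) \<Rightarrow> ('n::finite \<Rightarrow> nat) \<Rightarrow> real^'n \<Rightarrow> real^'n \<Rightarrow> real^'n" where
  "carnot_mult br \<sigma> x y = bch br (carnot_step \<sigma>) x y"

definition exp_dir :: "'n::finite \<Rightarrow> real \<Rightarrow> real^'n" where
  "exp_dir j t = t *\<^sub>R axis j 1"

definition dil :: "('n::finite \<Rightarrow> nat) \<Rightarrow> real \<Rightarrow> real^'n \<Rightarrow> real^'n" where
  "dil \<sigma> r x = (\<chi> i. r ^ \<sigma> i * x $ i)"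

definition Pi_plane :: "'n::finite \<Rightarrow> (real^'n) set" where
  "Pi_plane j = {x. x $ j = 0}"

definition Pr ::
  "(real^'n \<Rightarrow> real^'n \<Rightarrow> real^'n) \<Rightarrow> ('n::finite \<Rightarrow> nat) \<Rightarrow> 'n \<Rightarrow> real^'n \<Rightarrow> real^'n" where
  "Pr br \<sigma> j x = (THE p. p \<in> Pi_plane j \<and> x = carnot_mult br \<sigma> p (exp_dir j (x $ j)))"

end

theory Submission
  imports Defs "HOL-Computational_Algebra.Formal_Power_Series"
begin

text \<open>In exponential coordinates the group law is Dynkin's form of the
  Baker-Campbell-Hausdorff series.  Once it is known to be associative, everything
  follows from three of its properties: it is addition on each line \<open>\<real> X\<close>, it commutes
  with the dilations (which are Lie algebra automorphisms), and its \<open>j\<close>-th coordinate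
  is \<open>x\<^sub>j + y\<^sub>j\<close> when \<open>X\<^sub>j \<in> V\<^sub>1\<close>, because all brackets lie in \<open>V\<^sub>2 \<oplus> \<dots> \<oplus> V\<^sub>m\<close>.  Hence
  \<open>Pr\<^sub>j(x) = x \<cdot> exp(-x\<^sub>j X\<^sub>j)\<close>, and both claims become one-line computations.

  Associativity is the real work.  In the algebra of formal series in two
  noncommuting letters, \<open>Z = log(e\<^sup>X e\<^sup>Y)\<close> is primitive for the coproduct, so by the
  Dynkin-Specht-Wever lemma each homogeneous part of \<open>Z\<close>, divided by its degree, is
  obtained by replacing words with right-nested commutators; expanding the logarithm
  then gives exactly Dynkin's formula.  Evaluating these identities in a real algebra
  in which all products of more than \<open>m\<close> letters vanish shows that
  \<open>exp(\<rho>(x \<cdot> y)) = exp(\<rho> x) exp(\<rho> y)\<close> for every Lie algebra representation \<open>\<rho>\<close> by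
  nilpotent operators, where \<open>exp\<close> and \<open>log\<close> are truncated and mutually inverse.  The
  representation \<open>\<rho>(X)(v, t) = ([X, v] - t D X, 0)\<close> on \<open>\<g> \<times> \<real>\<close>, with \<open>D\<close> the grading
  derivation, is nilpotent and faithful.\<close>

section \<open>Formal series in noncommuting variables\<close>

text \<open>Series are indexed by a monoid in which every element has finitely many
  splittings \<open>w = u + v\<close>, so that the Cauchy product is a finite sum.  The instances
  used are words (the free monoid) and pairs of words (the tensor square).\<close>

class graded_monoid = monoid_add +
  fixes grade :: "'a \<Rightarrow> nat"
  assumes grade_add: "grade (a + b) = grade a + grade b"
    and grade_eq_0_iff: "grade a = 0 \<longleftrightarrow> a = 0"
    and finite_splittings: "finite {p. fst p + snd p = w}"

instantiation list :: (type) monoid_add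
begin
definition zero_list_def: "(0::'a list) = []"
definition plus_list_def: "(u::'a list) + v = u @ v"
instance
proof
  fix a b c :: "'a list"
  show "a + b + c = a + (b + c)" by (simp add: plus_list_def)
  show "0 + a = a" by (simp add: plus_list_def zero_list_def)
  show "a + 0 = a" by (simp add: plus_list_def zero_list_def)
qed
end

lemma plus_list_eq_append [simp]: "(u::'a list) + v = u @ v"
  by (simp add: plus_list_def)

lemma zero_list_eq_Nil [simp]: "(0::'a list) = []"
  by (simp add: zero_list_def)

instantiation list :: (type) graded_monoid
begin
definition grade_list_def: "grade (w::'a list) = length w"
instance
proof
  fix w :: "'a list"
  have "{p. fst p + snd p = w} \<subseteq> (\<lambda>i. (take i w, drop i w)) ` {0..length w}"
  proof
    fix p :: "'a list \<times> 'a list"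
    assume "p \<in> {p. fst p + snd p = w}"
    then have "w = fst p @ snd p" by simp
    then show "p \<in> (\<lambda>i. (take i w, drop i w)) ` {0..length w}"
      by (intro image_eqI[where x = "length (fst p)"]) auto
  qed
  then show "finite {p. fst p + snd p = w}"
    by (rule finite_subset) simp
next
  fix a b :: "'a list"
  show "grade (a + b) = grade a + grade b"
    by (simp add: grade_list_def)
  show "grade a = 0 \<longleftrightarrow> a = 0"
    by (simp add: grade_list_def)
qed
end

lemma grade_list [simp]: "grade (w::'a list) = length w"
  by (simp add: grade_list_def)

instantiation prod :: (graded_monoid, graded_monoid) graded_monoid
begin
definition grade_prod_def: "grade (p::'a \<times> 'b) = grade (fst p) + grade (snd p)"
instance
proof
  fix a b :: "'a \<times> 'b"
  show "grade (a + b) = grade a + grade b"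
    by (cases a; cases b) (simp add: grade_prod_def grade_add)
  show "(grade a = 0) = (a = 0)"
    by (cases a) (simp add: grade_prod_def grade_eq_0_iff zero_prod_def)
next
  fix w :: "'a \<times> 'b"
  let ?swap = "\<lambda>(x, y). ((fst x, fst y), (snd x, snd y))"
  have "{p. fst p + snd p = w} \<subseteq> ?swap ` ({p. fst p + snd p = fst w} \<times> {p. fst p + snd p = snd w})"
  proof
    fix p :: "('a \<times> 'b) \<times> ('a \<times> 'b)" assume "p \<in> {p. fst p + snd p = w}"
    then show "p \<in> ?swap ` ({p. fst p + snd p = fst w} \<times> {p. fst p + snd p = snd w})"
      by (cases p; cases w) (auto simp: image_iff plus_prod_def
          intro!: bexI[where x = "((fst (fst p), fst (snd p)), (snd (fst p), snd (snd p)))"])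
  qed
  then show "finite {p. fst p + snd p = w}"
    by (rule finite_subset) (intro finite_imageI finite_cartesian_product finite_splittings)
qed
end

lemma grade_pair [simp]: "grade ((u, v)::'a::graded_monoid \<times> 'b::graded_monoid) = grade u + grade v"
  by (simp add: grade_prod_def)

lemma grade_0 [simp]: "grade (0::'a::graded_monoid) = 0"
  by (simp add: grade_eq_0_iff)

definition splittings :: "'a::graded_monoid \<Rightarrow> ('a \<times> 'a) set" where
  "splittings w = {p. fst p + snd p = w}"

lemma finite_splittings_set [simp]: "finite (splittings w)"
  by (simp add: splittings_def finite_splittings)

lemma mem_splittings [simp]: "p \<in> splittings w \<longleftrightarrow> fst p + snd p = w"
  by (simp add: splittings_def)

lemma splittings_0: "splittings (0::'a::graded_monoid) = {(0, 0)}"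
proof (rule set_eqI)
  fix p :: "'a \<times> 'a"
  have "p = (0, 0)" if "fst p + snd p = 0"
  proof -
    have "grade (fst p) + grade (snd p) = 0"
      using arg_cong[OF that, of grade] by (simp only: grade_add grade_0)
    then have "fst p = 0" "snd p = 0"
      by (simp_all add: grade_eq_0_iff)
    then show ?thesis
      by (cases p) simp
  qed
  then show "p \<in> splittings 0 \<longleftrightarrow> p \<in> {(0, 0)}"
    by auto
qed

lemma sum_delta_mult:
  fixes h :: "'b \<Rightarrow> real"
  assumes "finite A" "a \<in> A"
  shows "(\<Sum>x\<in>A. (if x = a then 1 else 0) * h x) = h a"
proof -
  have "(\<Sum>x\<in>A. (if x = a then 1 else 0) * h x) = (\<Sum>x\<in>A. if x = a then h x else 0)"
    by (rule sum.cong) auto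
  then show ?thesis using assms by (simp add: sum.delta)
qed

lemma sum_eq_single_term:
  assumes "finite A" "a \<in> A" "\<And>x. x \<in> A \<Longrightarrow> x \<noteq> a \<Longrightarrow> f x = 0"
  shows "sum f A = f a"
proof -
  have "sum f A = sum f {a}"
    by (rule sum.mono_neutral_right) (use assms in auto)
  then show ?thesis by simp
qed

datatype 'm series = Series (coef: "'m \<Rightarrow> real")

lemma series_eqI: "(\<And>w. coef f w = coef g w) \<Longrightarrow> f = g"
  by (cases f; cases g) auto

instantiation series :: (graded_monoid) real_algebra_1
begin
definition "0 = Series (\<lambda>_. 0)"
definition "1 = Series (\<lambda>w. if w = 0 then 1 else 0)"
definition "f + g = Series (\<lambda>w. coef f w + coef g w)"
definition "f - g = Series (\<lambda>w. coef f w - coef g w)"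
definition "- f = Series (\<lambda>w. - coef f w)"
definition "scaleR c f = Series (\<lambda>w. c * coef f w)"
definition "f * g = Series (\<lambda>w. \<Sum>p\<in>splittings w. coef f (fst p) * coef g (snd p))"

lemma coef_simps [simp]:
  "coef 0 w = 0" "coef 1 w = (if w = 0 then 1 else 0)"
  "coef (f + g) w = coef f w + coef g w"  "coef (f - g) w = coef f w - coef g w"
  "coef (- f) w = - coef f w" "coef (scaleR c f) w = c * coef f w"
  by (simp_all add: zero_series_def one_series_def plus_series_def minus_series_def uminus_series_def scaleR_series_def)

lemma coef_mult: "coef (f * g) w = (\<Sum>p\<in>splittings w. coef f (fst p) * coef g (snd p))"
  by (simp add: times_series_def)

lemma sum_splittings_unit_left: "(\<Sum>p\<in>splittings w. (if fst p = 0 then 1 else 0) * h (snd p)) = (h w :: real)"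
proof -
  have "(\<Sum>p\<in>splittings w. (if fst p = 0 then 1 else 0) * h (snd p)) = (\<Sum>p\<in>splittings w. if p = (0, w) then h w else 0)"
    by (rule sum.cong) auto
  also have "\<dots> = h w" by (simp add: sum.delta')
  finally show ?thesis .
qed

lemma sum_splittings_unit_right: "(\<Sum>p\<in>splittings w. h (fst p) * (if snd p = 0 then 1 else 0)) = (h w :: real)"
proof -
  have "(\<Sum>p\<in>splittings w. h (fst p) * (if snd p = 0 then 1 else 0)) = (\<Sum>p\<in>splittings w. if p = (w, 0) then h w else 0)"
    by (rule sum.cong) auto
  also have "\<dots> = h w" by (simp add: sum.delta')
  finally show ?thesis .
qed

lemma sum_splittings_assoc:
  "(\<Sum>p\<in>splittings w. (\<Sum>q\<in>splittings (fst p). F (fst q) (snd q) (snd p))) =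
   (\<Sum>p\<in>splittings w. (\<Sum>q\<in>splittings (snd p). F (fst p) (fst q) (snd q)))"
proof -
  have "(\<Sum>p\<in>splittings w. (\<Sum>q\<in>splittings (fst p). F (fst q) (snd q) (snd p))) =
        (\<Sum>z\<in>Sigma (splittings w) (\<lambda>p. splittings (fst p)). F (fst (snd z)) (snd (snd z)) (snd (fst z)))"
    by (subst sum.Sigma) (auto simp: split_beta)
  also have "\<dots> = (\<Sum>z\<in>Sigma (splittings w) (\<lambda>p. splittings (snd p)). F (fst (fst z)) (fst (snd z)) (snd (snd z)))"
    by (rule sum.reindex_bij_witness[where i="\<lambda>z. ((fst (fst z) + fst (snd z), snd (snd z)), (fst (fst z), fst (snd z)))"
          and j="\<lambda>z. ((fst (snd z), snd (snd z) + snd (fst z)), (snd (snd z), snd (fst z)))"])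
       (auto simp: add.assoc)
  also have "\<dots> = (\<Sum>p\<in>splittings w. (\<Sum>q\<in>splittings (snd p). F (fst p) (fst q) (snd q)))"
    by (subst sum.Sigma) (auto simp: split_beta)
  finally show ?thesis .
qed

instance
proof
  fix a b c :: "'a series" and r s :: real
  show "a * b * c = a * (b * c)"
    by (rule series_eqI) (simp add: coef_mult sum_distrib_left sum_distrib_right mult.assoc
          sum_splittings_assoc[where F="\<lambda>x y z. coef a x * (coef b y * coef c z)"])
  show "1 * a = a" by (rule series_eqI) (simp add: coef_mult sum_splittings_unit_left)
  show "a * 1 = a" by (rule series_eqI) (simp add: coef_mult sum_splittings_unit_right)
  show "(a + b) * c = a * c + b * c"
    by (rule series_eqI) (simp add: coef_mult algebra_simps sum.distrib)
  show "a * (b + c) = a * b + a * c"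
    by (rule series_eqI) (simp add: coef_mult algebra_simps sum.distrib)
  show "(0::'a series) \<noteq> 1" by (metis coef_simps(1,2) zero_neq_one)
  show "a + b + c = a + (b + c)" by (rule series_eqI) simp
  show "a + b = b + a" by (rule series_eqI) simp
  show "0 + a = a" by (rule series_eqI) simp
  show "- a + a = 0" by (rule series_eqI) simp
  show "a - b = a + - b" by (rule series_eqI) simp
  show "scaleR r (a + b) = scaleR r a + scaleR r b" by (rule series_eqI) (simp add: algebra_simps)
  show "scaleR (r + s) a = scaleR r a + scaleR s a" by (rule series_eqI) (simp add: algebra_simps)
  show "scaleR r (scaleR s a) = scaleR (r * s) a" by (rule series_eqI) simp
  show "scaleR 1 a = a" by (rule series_eqI) simp
  show "scaleR r a * b = scaleR r (a * b)"
    by (rule series_eqI) (simp add: coef_mult sum_distrib_left mult.assoc)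
  show "a * scaleR r b = scaleR r (a * b)"
    by (rule series_eqI) (simp add: coef_mult sum_distrib_left algebra_simps)
qed
end

lemma coef_sum: "coef (sum f A) w = (\<Sum>x\<in>A. coef (f x) w)"
  by (induct A rule: infinite_finite_induct) auto

lemma coef_mult_0: "coef (f * g) (0::'a::graded_monoid) = coef f 0 * coef g 0"
  by (simp add: coef_mult splittings_0)

section \<open>Substituting a series into a power series\<close>

definition vanishes_below :: "'a::graded_monoid series \<Rightarrow> nat \<Rightarrow> bool" where
  "vanishes_below f k \<longleftrightarrow> (\<forall>w. grade w < k \<longrightarrow> coef f w = 0)"

lemma vanishes_belowD: "vanishes_below f k \<Longrightarrow> grade w < k \<Longrightarrow> coef f w = 0"
  by (simp add: vanishes_below_def)

lemma vanishes_below_0 [simp]: "vanishes_below f 0" by (simp add: vanishes_below_def)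

lemma vanishes_below_1_iff: "vanishes_below f 1 \<longleftrightarrow> coef f 0 = 0"
  by (auto simp: vanishes_below_def grade_eq_0_iff)

lemma vanishes_below_mult:
  assumes "vanishes_below f i" "vanishes_below g j" shows "vanishes_below (f * g) (i + j)"
  unfolding vanishes_below_def
proof (intro allI impI)
  fix w :: 'a assume w: "grade w < i + j"
  have "coef f (fst p) * coef g (snd p) = 0" if "p \<in> splittings w" for p
  proof -
    from that have "grade (fst p) + grade (snd p) = grade w" by (simp add: grade_add[symmetric])
    with w have "grade (fst p) < i \<or> grade (snd p) < j" by linarith
    then show ?thesis using assms by (auto simp: vanishes_below_def)
  qed
  then show "coef (f * g) w = 0" by (auto simp: coef_mult intro!: sum.neutral)
qed

lemma vanishes_below_power: "vanishes_below f 1 \<Longrightarrow> vanishes_below (f ^ k) k"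
proof (induct k)
  case 0 then show ?case by simp
next
  case (Suc k) then show ?case using vanishes_below_mult[of f 1 "f^k" k] by simp
qed

lemma vanishes_below_add: "vanishes_below f k \<Longrightarrow> vanishes_below g k \<Longrightarrow> vanishes_below (f + g) k"
  by (simp add: vanishes_below_def)

lemma vanishes_below_scaleR: "vanishes_below f k \<Longrightarrow> vanishes_below (c *\<^sub>R f) k"
  by (simp add: vanishes_below_def)

lemma coef_power_below: "vanishes_below f 1 \<Longrightarrow> grade w < k \<Longrightarrow> coef (f ^ k) w = 0"
  using vanishes_below_power vanishes_belowD by blast

text \<open>Once \<open>a\<close> has no constant term, only the powers \<open>a\<^sup>k\<close> with \<open>k \<le> grade w\<close> contribute
  to the coefficient of \<open>w\<close> in \<open>F(a)\<close>; the definition truncates there, so it means \<open>F(a)\<close>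
  only under that hypothesis.\<close>

definition eval_fps :: "'a::graded_monoid series \<Rightarrow> real fps \<Rightarrow> 'a series" where
  "eval_fps a F = Series (\<lambda>w. \<Sum>k\<le>grade w. fps_nth F k * coef (a ^ k) w)"

lemma coef_eval_fps: "coef (eval_fps a F) w = (\<Sum>k\<le>grade w. fps_nth F k * coef (a ^ k) w)"
  by (simp add: eval_fps_def)

lemma coef_eval_fps_upto:
  assumes "vanishes_below a 1" "grade w \<le> N"
  shows "coef (eval_fps a F) w = (\<Sum>k\<le>N. fps_nth F k * coef (a ^ k) w)"
  unfolding coef_eval_fps
  by (rule sum.mono_neutral_left) (use assms coef_power_below[OF assms(1)] in \<open>auto simp: not_le\<close>)

lemma eval_fps_add: "eval_fps a (F + G) = eval_fps a F + eval_fps a G"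
  by (rule series_eqI) (simp add: coef_eval_fps algebra_simps sum.distrib)

lemma eval_fps_diff: "eval_fps a (F - G) = eval_fps a F - eval_fps a G"
  by (rule series_eqI) (simp add: coef_eval_fps algebra_simps sum_subtractf)

lemma eval_fps_1: "eval_fps a 1 = 1"
  by (rule series_eqI) (auto simp: coef_eval_fps grade_eq_0_iff sum.atMost_shift)

lemma eval_fps_X: "vanishes_below a 1 \<Longrightarrow> eval_fps a fps_X = a"
proof (rule series_eqI)
  fix w assume a: "vanishes_below a 1"
  show "coef (eval_fps a fps_X) w = coef a w"
  proof (cases "grade w = 0")
    case True then show ?thesis
      using vanishes_belowD[OF a, of 0] by (simp add: coef_eval_fps grade_eq_0_iff)
  next
    case False
    then have "coef (eval_fps a fps_X) w = (\<Sum>k\<le>grade w. if k = 1 then coef a w else 0)"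
      unfolding coef_eval_fps by (intro sum.cong) (auto simp: fps_X_def)
    also have "\<dots> = coef a w" using False by (simp add: sum.delta)
    finally show ?thesis .
  qed
qed

lemma sum_square_eq_sum_triangle:
  fixes h :: "nat \<Rightarrow> nat \<Rightarrow> real"
  assumes "\<And>i j. i \<le> d \<Longrightarrow> j \<le> d \<Longrightarrow> d < i + j \<Longrightarrow> h i j = 0"
  shows "(\<Sum>i\<le>d. \<Sum>j\<le>d. h i j) = (\<Sum>k\<le>d. \<Sum>i\<le>k. h i (k - i))"
proof -
  have "(\<Sum>i\<le>d. \<Sum>j\<le>d. h i j) = (\<Sum>(i,j)\<in>{..d} \<times> {..d}. h i j)"
    by (simp add: sum.cartesian_product)
  also have "\<dots> = (\<Sum>(i,j)\<in>{(i,j). i + j \<le> d}. h i j)"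
    by (rule sum.mono_neutral_right) (auto, metis assms not_le)
  also have "\<dots> = (\<Sum>k\<le>d. \<Sum>i\<le>k. h i (k - i))"
    by (rule sum.triangle_reindex_eq)
  finally show ?thesis .
qed

lemma coef_eval_fps_mult:
  assumes a: "vanishes_below a 1" and b: "vanishes_below b 1"
  shows "coef (eval_fps a F * eval_fps b G) w =
    (\<Sum>i\<le>grade w. \<Sum>j\<le>grade w. fps_nth F i * fps_nth G j * coef (a ^ i * b ^ j) w)"
proof -
  have "coef (eval_fps a F * eval_fps b G) w =
     (\<Sum>p\<in>splittings w. (\<Sum>i\<le>grade w. fps_nth F i * coef (a ^ i) (fst p)) * (\<Sum>j\<le>grade w. fps_nth G j * coef (b ^ j) (snd p)))"
    unfolding coef_mult
  proof (rule sum.cong[OF refl])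
    fix p assume "p \<in> splittings w"
    then have "grade (fst p) \<le> grade w" "grade (snd p) \<le> grade w"
      by (auto simp: grade_add)
    then show "coef (eval_fps a F) (fst p) * coef (eval_fps b G) (snd p) =
      (\<Sum>i\<le>grade w. fps_nth F i * coef (a ^ i) (fst p)) * (\<Sum>j\<le>grade w. fps_nth G j * coef (b ^ j) (snd p))"
      using coef_eval_fps_upto[OF a] coef_eval_fps_upto[OF b] by simp
  qed
  also have "\<dots> = (\<Sum>i\<le>grade w. \<Sum>j\<le>grade w. fps_nth F i * fps_nth G j * coef (a ^ i * b ^ j) w)"
    by (simp add: coef_mult sum_distrib_left sum_distrib_right algebra_simps sum.swap[of _ "splittings w"])
       (rule sum.cong[OF refl], rule sum.swap)
  finally show ?thesis .
qed

lemma eval_fps_mult: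
  fixes a :: "'a::graded_monoid series"
  assumes a: "vanishes_below a 1"
  shows "eval_fps a (F * G) = eval_fps a F * eval_fps a G"
proof (rule series_eqI)
  fix w :: 'a
  let ?d = "grade w"
  have "coef (eval_fps a F * eval_fps a G) w = (\<Sum>i\<le>?d. \<Sum>j\<le>?d. fps_nth F i * fps_nth G j * coef (a ^ (i + j)) w)"
    by (simp add: coef_eval_fps_mult[OF a a] power_add)
  also have "\<dots> = (\<Sum>k\<le>?d. \<Sum>i\<le>k. fps_nth F i * fps_nth G (k - i) * coef (a ^ (i + (k - i))) w)"
    by (rule sum_square_eq_sum_triangle) (use coef_power_below[OF a] in auto)
  also have "\<dots> = (\<Sum>k\<le>?d. (\<Sum>i\<le>k. fps_nth F i * fps_nth G (k - i)) * coef (a ^ k) w)"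
    by (simp add: sum_distrib_right)
  also have "\<dots> = coef (eval_fps a (F * G)) w"
    by (simp add: coef_eval_fps fps_mult_nth atLeast0AtMost)
  finally show "coef (eval_fps a (F * G)) w = coef (eval_fps a F * eval_fps a G) w" by simp
qed

lemma eval_fps_power: "vanishes_below a 1 \<Longrightarrow> eval_fps a (F ^ k) = eval_fps a F ^ k"
  by (induct k) (simp_all add: eval_fps_1 eval_fps_mult)

lemma vanishes_below_eval_fps: "fps_nth F 0 = 0 \<Longrightarrow> vanishes_below (eval_fps a F) 1"
  unfolding vanishes_below_def by (auto simp: coef_eval_fps grade_eq_0_iff)

lemma eval_fps_compose:
  fixes a :: "'a::graded_monoid series"
  assumes a: "vanishes_below a 1" and G0: "fps_nth G 0 = 0"
  shows "eval_fps (eval_fps a G) F = eval_fps a (F oo G)"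
proof (rule series_eqI)
  fix w :: 'a
  let ?d = "grade w"
  have b: "vanishes_below (eval_fps a G) 1" using G0 by (rule vanishes_below_eval_fps)
  have "coef (eval_fps (eval_fps a G) F) w = (\<Sum>k\<le>?d. fps_nth F k * coef (eval_fps a (G ^ k)) w)"
    by (simp add: coef_eval_fps eval_fps_power[OF a])
  also have "\<dots> = (\<Sum>k\<le>?d. \<Sum>j\<le>?d. fps_nth F k * (fps_nth (G ^ k) j * coef (a ^ j) w))"
    by (simp add: coef_eval_fps sum_distrib_left)
  also have "\<dots> = (\<Sum>j\<le>?d. (\<Sum>k\<le>j. fps_nth F k * fps_nth (G ^ k) j) * coef (a ^ j) w)"
  proof -
    have "(\<Sum>k\<le>?d. \<Sum>j\<le>?d. fps_nth F k * (fps_nth (G ^ k) j * coef (a ^ j) w)) =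
          (\<Sum>j\<le>?d. \<Sum>k\<le>?d. fps_nth F k * (fps_nth (G ^ k) j * coef (a ^ j) w))"
      by (rule sum.swap)
    also have "\<dots> = (\<Sum>j\<le>?d. \<Sum>k\<le>j. fps_nth F k * (fps_nth (G ^ k) j * coef (a ^ j) w))"
    proof (rule sum.cong[OF refl])
      fix j assume "j \<in> {..?d}"
      then show "(\<Sum>k\<le>?d. fps_nth F k * (fps_nth (G ^ k) j * coef (a ^ j) w)) =
            (\<Sum>k\<le>j. fps_nth F k * (fps_nth (G ^ k) j * coef (a ^ j) w))"
        by (intro sum.mono_neutral_right) (auto simp: startsby_zero_power_prefix[OF G0])
    qed
    finally show ?thesis by (simp add: sum_distrib_right mult.assoc)
  qed
  also have "\<dots> = coef (eval_fps a (F oo G)) w"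
    by (simp add: coef_eval_fps fps_compose_nth atLeast0AtMost)
  finally show "coef (eval_fps (eval_fps a G) F) w = coef (eval_fps a (F oo G)) w" .
qed

definition series_exp :: "'a::graded_monoid series \<Rightarrow> 'a series" where
  "series_exp a = eval_fps a (fps_exp 1)"
definition series_log1p :: "'a::graded_monoid series \<Rightarrow> 'a series" where
  "series_log1p a = eval_fps a (fps_ln 1)"

lemma fps_exp_compose_ln: "fps_exp (1::real) oo fps_ln 1 = fps_X + 1"
proof -
  have "(fps_exp (1::real) - 1) oo fps_ln 1 = fps_X"
    using fps_inv_fps_exp_compose(2)[of "1::real"] fps_ln_fps_exp_inv[of "1::real"] by simp
  have "fps_exp (1::real) oo fps_ln 1 = ((fps_exp 1 - 1) + 1) oo fps_ln 1" by simp
  also have "\<dots> = ((fps_exp 1 - 1) oo fps_ln 1) + (1 oo fps_ln 1)"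
    by (rule fps_compose_add_distrib)
  finally show ?thesis using \<open>(fps_exp (1::real) - 1) oo fps_ln 1 = fps_X\<close> by simp
qed

lemma fps_ln_compose_exp_minus_1: "fps_ln (1::real) oo (fps_exp 1 - 1) = fps_X"
  using fps_inv_fps_exp_compose(1)[of "1::real"] fps_ln_fps_exp_inv[of "1::real"] by simp

lemma series_exp_log1p: "vanishes_below a 1 \<Longrightarrow> series_exp (series_log1p a) = 1 + a"
  unfolding series_exp_def series_log1p_def
  by (simp add: eval_fps_compose fps_exp_compose_ln eval_fps_add eval_fps_X eval_fps_1)

lemma series_exp_minus_1: "series_exp a - 1 = eval_fps a (fps_exp 1 - 1)"
  by (simp add: series_exp_def eval_fps_diff eval_fps_1)

lemma series_log1p_exp: "vanishes_below a 1 \<Longrightarrow> series_log1p (series_exp a - 1) = a"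
  unfolding series_exp_minus_1 series_log1p_def
  by (simp add: eval_fps_compose fps_ln_compose_exp_minus_1 eval_fps_X)

lemma vanishes_below_series_exp_minus_1: "vanishes_below (series_exp a - 1) 1"
  unfolding series_exp_minus_1 by (rule vanishes_below_eval_fps) simp

lemma vanishes_below_series_log1p: "vanishes_below (series_log1p a) 1"
  unfolding series_log1p_def by (rule vanishes_below_eval_fps) simp

text \<open>The library's binomial theorem needs a commutative ring; its proof only ever
  moves \<open>b\<close> past powers of \<open>a\<close>.\<close>

lemma commuting_binomial_terms:
  fixes a b :: "'a::ring_1"
  assumes ab: "a * b = b * a"
  shows "a * (of_nat c * a^k * b^m) = of_nat c * a^(k+1) * b^m"
    and "b * (of_nat c * a^k * b^m) = of_nat c * a^k * b^(m+1)"
proof -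
  have "a * (of_nat c * (a^k * b^m)) = (a * of_nat c) * (a^k * b^m)" by (simp add: mult.assoc)
  also have "\<dots> = of_nat c * (a * (a^k * b^m))" by (simp add: mult_of_nat_commute mult.assoc)
  finally show "a * (of_nat c * a^k * b^m) = of_nat c * a^(k+1) * b^m" by (simp add: mult.assoc)
  have "b * (of_nat c * (a^k * b^m)) = (b * of_nat c) * (a^k * b^m)" by (simp add: mult.assoc)
  also have "\<dots> = of_nat c * ((b * a^k) * b^m)" by (simp add: mult_of_nat_commute mult.assoc)
  also have "\<dots> = of_nat c * (a^k * (b * b^m))"
    using power_commuting_commutes[OF ab, of k, symmetric] by (simp add: mult.assoc)
  finally show "b * (of_nat c * a^k * b^m) = of_nat c * a^k * b^(m+1)" by (simp add: mult.assoc)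
qed

lemma binomial_commuting:
  fixes a b :: "'a::ring_1"
  assumes ab: "a * b = b * a"
  shows "(a + b)^n = (\<Sum>k\<le>n. of_nat (n choose k) * a^k * b^(n-k))"
proof (induct n)
  case 0
  then show ?case by simp
next
  case (Suc n)
  have decomp: "{0..n+1} = {0} \<union> {n + 1} \<union> {1..n}"
    by auto
  have "(a + b)^(n+1) = (a + b) * (\<Sum>k\<le>n. of_nat (n choose k) * a^k * b^(n - k))"
    using Suc.hyps by simp
  also have "\<dots> = a * (\<Sum>k\<le>n. of_nat (n choose k) * a^k * b^(n-k)) +
      b * (\<Sum>k\<le>n. of_nat (n choose k) * a^k * b^(n-k))"
    by (rule distrib_right)
  also have "\<dots> = (\<Sum>k\<le>n. of_nat (n choose k) * a^(k+1) * b^(n-k)) +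
      (\<Sum>k\<le>n. of_nat (n choose k) * a^k * b^(n - k + 1))"
    by (simp only: sum_distrib_left commuting_binomial_terms[OF ab])
  also have "\<dots> = (\<Sum>k\<le>n. of_nat (n choose k) * a^k * b^(n + 1 - k)) +
      (\<Sum>k=1..n+1. of_nat (n choose (k - 1)) * a^k * b^(n + 1 - k))"
    by (simp add: atMost_atLeast0 sum.shift_bounds_cl_Suc_ivl Suc_diff_le field_simps del: sum.cl_ivl_Suc)
  also have "\<dots> = b^(n + 1) +
      (\<Sum>k=1..n. of_nat (n choose k) * a^k * b^(n + 1 - k)) + (a^(n + 1) +
      (\<Sum>k=1..n. of_nat (n choose (k - 1)) * a^k * b^(n + 1 - k)))"
      using sum.nat_ivl_Suc' [of 1 n "\<lambda>k. of_nat (n choose (k-1)) * a ^ k * b ^ (n + 1 - k)"]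
    by (simp add: sum.atLeast_Suc_atMost atMost_atLeast0)
  also have "\<dots> = a^(n + 1) + b^(n + 1) +
      (\<Sum>k=1..n. of_nat (n + 1 choose k) * a^k * b^(n + 1 - k))"
    by (auto simp add: algebra_simps sum.distrib [symmetric] choose_reduce_nat)
  also have "\<dots> = (\<Sum>k\<le>n+1. of_nat (n + 1 choose k) * a^k * b^(n + 1 - k))"
    using decomp by (simp add: atMost_atLeast0 algebra_simps)
  finally show ?case
    by simp
qed

lemma of_nat_series: "(of_nat c :: 'a::graded_monoid series) = real c *\<^sub>R 1"
  by (simp add: of_real_def[symmetric])

lemma series_exp_add_commuting:
  fixes a b :: "'a::graded_monoid series"
  assumes a: "vanishes_below a 1" and b: "vanishes_below b 1" and ab: "a * b = b * a"
  shows "series_exp (a + b) = series_exp a * series_exp b"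
proof (rule series_eqI)
  fix w :: 'a
  let ?d = "grade w"
  have ab1: "vanishes_below (a + b) 1" using a b by (rule vanishes_below_add)
  have low: "coef (a ^ i * b ^ j) w = 0" if "?d < i + j" for i j
    using vanishes_below_mult[OF vanishes_below_power[OF a, of i] vanishes_below_power[OF b, of j]] that vanishes_belowD
      by blast
  have "coef (series_exp a * series_exp b) w = (\<Sum>i\<le>?d. \<Sum>j\<le>?d. coef (a ^ i * b ^ j) w / (fact i * fact j))"
    unfolding series_exp_def coef_eval_fps_mult[OF a b] by (simp add: field_simps)
  also have "\<dots> = (\<Sum>k\<le>?d. \<Sum>i\<le>k. coef (a ^ i * b ^ (k - i)) w / (fact i * fact (k - i)))"
    by (rule sum_square_eq_sum_triangle) (simp add: low)
  also have "\<dots> = (\<Sum>k\<le>?d. coef ((a + b) ^ k) w / fact k)"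
  proof (rule sum.cong[OF refl])
    fix k
    have "coef ((a + b) ^ k) w / fact k = (\<Sum>i\<le>k. real (k choose i) * coef (a ^ i * b ^ (k - i)) w) / fact k"
    proof -
      have "coef ((a + b) ^ k) w = (\<Sum>i\<le>k. coef (of_nat (k choose i) * a ^ i * b ^ (k - i)) w)"
        by (simp add: binomial_commuting[OF ab] coef_sum)
      also have "\<dots> = (\<Sum>i\<le>k. real (k choose i) * coef (a ^ i * b ^ (k - i)) w)"
        by (simp add: of_nat_series mult.assoc)
      finally show ?thesis by simp
    qed
    also have "\<dots> = (\<Sum>i\<le>k. coef (a ^ i * b ^ (k - i)) w / (fact i * fact (k - i)))"
      by (simp add: sum_divide_distrib binomial_fact field_simps)
    finally show "(\<Sum>i\<le>k. coef (a ^ i * b ^ (k - i)) w / (fact i * fact (k - i))) = coef ((a + b) ^ k) w / fact k"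
      by simp
  qed
  also have "\<dots> = coef (series_exp (a + b)) w"
    by (simp add: series_exp_def coef_eval_fps)
  finally show "coef (series_exp (a + b)) w = coef (series_exp a * series_exp b) w" by simp
qed

section \<open>Substituting series for the letters\<close>

definition words_upto :: "nat \<Rightarrow> bool list set" where "words_upto n = {w. length w \<le> n}"

lemma finite_words_upto [simp]: "finite (words_upto n)"
  using finite_lists_length_le[of "UNIV::bool set" n] by (simp add: words_upto_def)

lemma mem_words_upto [simp]: "w \<in> words_upto n \<longleftrightarrow> length w \<le> n" by (simp add: words_upto_def)

lemma sum_words_upto_splittings:
  fixes H :: "bool list \<Rightarrow> bool list \<Rightarrow> 'v::comm_monoid_add"
  shows "(\<Sum>w\<in>words_upto d. \<Sum>p\<in>splittings w. H (fst p) (snd p)) =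
         (\<Sum>u\<in>words_upto d. \<Sum>v\<in>words_upto d. if length u + length v \<le> d then H u v else 0)"
proof -
  have "(\<Sum>w\<in>words_upto d. \<Sum>p\<in>splittings w. H (fst p) (snd p)) = (\<Sum>z\<in>Sigma (words_upto d) splittings. H (fst (snd z)) (snd (snd z)))"
    by (subst sum.Sigma) (auto simp: split_beta)
  also have "\<dots> = (\<Sum>q\<in>{q\<in>words_upto d \<times> words_upto d. length (fst q) + length (snd q) \<le> d}. H (fst q) (snd q))"
    by (rule sum.reindex_bij_witness[where i="\<lambda>q. (fst q @ snd q, q)" and j="snd"]) auto
  also have "\<dots> = (\<Sum>q\<in>words_upto d \<times> words_upto d. if length (fst q) + length (snd q) \<le> d then H (fst q) (snd q) else 0)"
    by (rule sum.inter_filter) simp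
  also have "\<dots> = (\<Sum>u\<in>words_upto d. \<Sum>v\<in>words_upto d. if length u + length v \<le> d then H u v else 0)"
    by (simp add: sum.cartesian_product split_beta)
  finally show ?thesis .
qed

fun word_prod :: "(bool \<Rightarrow> 'a::monoid_mult) \<Rightarrow> bool list \<Rightarrow> 'a" where
  "word_prod \<phi> [] = 1"
| "word_prod \<phi> (a # w) = \<phi> a * word_prod \<phi> w"

lemma word_prod_append: "word_prod \<phi> (u @ v) = word_prod \<phi> u * word_prod \<phi> v"
  by (induct u) (simp_all add: mult.assoc)

definition no_constant_terms :: "(bool \<Rightarrow> 'm::graded_monoid series) \<Rightarrow> bool" where
  "no_constant_terms \<phi> \<longleftrightarrow> (\<forall>a. vanishes_below (\<phi> a) 1)"

lemma vanishes_below_word_prod: "no_constant_terms \<phi> \<Longrightarrow> vanishes_below (word_prod \<phi> w) (length w)"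
proof (induct w)
  case Nil then show ?case by simp
next
  case (Cons a w)
  then show ?case
    using vanishes_below_mult[of "\<phi> a" 1 "word_prod \<phi> w" "length w"] by (simp add: no_constant_terms_def)
qed

lemma coef_word_prod_below: "no_constant_terms \<phi> \<Longrightarrow> grade m < length w \<Longrightarrow> coef (word_prod \<phi> w) m = 0"
  using vanishes_below_word_prod vanishes_belowD by blast

definition subst_letters :: "(bool \<Rightarrow> 'm::graded_monoid series) \<Rightarrow> bool list series \<Rightarrow> 'm series" where
  "subst_letters \<phi> f = Series (\<lambda>m. \<Sum>w\<in>words_upto (grade m). coef f w * coef (word_prod \<phi> w) m)"

lemma coef_subst_letters: "coef (subst_letters \<phi> f) m = (\<Sum>w\<in>words_upto (grade m). coef f w * coef (word_prod \<phi> w) m)"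
  by (simp add: subst_letters_def)

lemma coef_subst_letters_upto:
  assumes "no_constant_terms \<phi>" "grade m \<le> N"
  shows "coef (subst_letters \<phi> f) m = (\<Sum>w\<in>words_upto N. coef f w * coef (word_prod \<phi> w) m)"
  unfolding coef_subst_letters
  by (rule sum.mono_neutral_left) (use assms coef_word_prod_below[OF assms(1)] in auto)

lemma subst_letters_mult:
  assumes ok: "no_constant_terms \<phi>"
  shows "subst_letters \<phi> (f * g) = subst_letters \<phi> f * subst_letters \<phi> g"
proof (rule series_eqI)
  fix m :: 'a
  let ?d = "grade m"
  let ?P = "\<lambda>u. word_prod \<phi> u"
  have "coef (subst_letters \<phi> f * subst_letters \<phi> g) m =
    (\<Sum>p\<in>splittings m. (\<Sum>u\<in>words_upto ?d. coef f u * coef (?P u) (fst p)) * (\<Sum>v\<in>words_upto ?d. coef g v * coef (?P v) (snd p)))"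
    unfolding coef_mult
  proof (rule sum.cong[OF refl])
    fix p assume "p \<in> splittings m"
    then have "grade (fst p) \<le> ?d" "grade (snd p) \<le> ?d" by (auto simp: grade_add)
    then show "coef (subst_letters \<phi> f) (fst p) * coef (subst_letters \<phi> g) (snd p) =
      (\<Sum>u\<in>words_upto ?d. coef f u * coef (?P u) (fst p)) * (\<Sum>v\<in>words_upto ?d. coef g v * coef (?P v) (snd p))"
      using coef_subst_letters_upto[OF ok] by simp
  qed
  also have "\<dots> = (\<Sum>p\<in>splittings m. \<Sum>u\<in>words_upto ?d. \<Sum>v\<in>words_upto ?d. coef f u * coef (?P u) (fst p) * (coef g v * coef (?P v) (snd p)))"
    by (simp add: sum_product)
  also have "\<dots> = (\<Sum>u\<in>words_upto ?d. \<Sum>v\<in>words_upto ?d. \<Sum>p\<in>splittings m. coef f u * coef (?P u) (fst p) * (coef g v * coef (?P v) (snd p)))"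
    by (subst sum.swap) (rule sum.cong[OF refl], rule sum.swap)
  also have "\<dots> = (\<Sum>u\<in>words_upto ?d. \<Sum>v\<in>words_upto ?d. coef f u * coef g v * coef (?P (u @ v)) m)"
    by (simp add: word_prod_append coef_mult sum_distrib_left algebra_simps)
  also have "\<dots> = (\<Sum>u\<in>words_upto ?d. \<Sum>v\<in>words_upto ?d. if length u + length v \<le> ?d then coef f u * coef g v * coef (?P (u @ v)) m else 0)"
    by (intro sum.cong refl) (auto simp: coef_word_prod_below[OF ok])
  also have "\<dots> = (\<Sum>w\<in>words_upto ?d. \<Sum>p\<in>splittings w. coef f (fst p) * coef g (snd p) * coef (?P (fst p @ snd p)) m)"
    by (rule sum_words_upto_splittings[symmetric])
  also have "\<dots> = (\<Sum>w\<in>words_upto ?d. (\<Sum>p\<in>splittings w. coef f (fst p) * coef g (snd p)) * coef (?P w) m)"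
    by (intro sum.cong refl) (auto simp: sum_distrib_right)
  also have "\<dots> = coef (subst_letters \<phi> (f * g)) m"
    by (simp add: coef_subst_letters coef_mult)
  finally show "coef (subst_letters \<phi> (f * g)) m = coef (subst_letters \<phi> f * subst_letters \<phi> g) m"
    by simp
qed

lemma subst_letters_1: "subst_letters \<phi> 1 = 1"
  by (rule series_eqI) (simp add: coef_subst_letters sum_delta_mult)

lemma subst_letters_diff: "subst_letters \<phi> (f - g) = subst_letters \<phi> f - subst_letters \<phi> g"
  by (rule series_eqI) (simp add: coef_subst_letters algebra_simps sum_subtractf)

lemma subst_letters_power: "no_constant_terms \<phi> \<Longrightarrow> subst_letters \<phi> (f ^ k) = subst_letters \<phi> f ^ k"
  by (induct k) (simp_all add: subst_letters_1 subst_letters_mult)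

definition letter :: "bool \<Rightarrow> bool list series" where
  "letter a = Series (\<lambda>w. if w = [a] then 1 else 0)"

lemma coef_letter: "coef (letter a) w = (if w = [a] then 1 else 0)"
  by (simp add: letter_def)

lemma subst_letters_letter:
  assumes ok: "no_constant_terms \<phi>" shows "subst_letters \<phi> (letter a) = \<phi> a"
proof (rule series_eqI)
  fix m :: 'a
  show "coef (subst_letters \<phi> (letter a)) m = coef (\<phi> a) m"
  proof (cases "grade m = 0")
    case True
    then have "coef (\<phi> a) m = 0" using ok by (auto simp: no_constant_terms_def vanishes_below_def)
    moreover have "coef (subst_letters \<phi> (letter a)) m = 0" using True
      by (auto simp: coef_subst_letters coef_letter intro!: sum.neutral)
    ultimately show ?thesis by simp
  next
    case False
    then show ?thesis by (simp add: coef_subst_letters coef_letter sum_delta_mult)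
  qed
qed

lemma vanishes_below_subst_letters: "vanishes_below f 1 \<Longrightarrow> vanishes_below (subst_letters \<phi> f) 1"
  by (auto simp: vanishes_below_def coef_subst_letters grade_eq_0_iff)

lemma subst_letters_eval_fps:
  assumes ok: "no_constant_terms \<phi>" and a: "vanishes_below a 1"
  shows "subst_letters \<phi> (eval_fps a F) = eval_fps (subst_letters \<phi> a) F"
proof (rule series_eqI)
  fix m :: 'a
  let ?d = "grade m"
  have "coef (subst_letters \<phi> (eval_fps a F)) m = (\<Sum>w\<in>words_upto ?d. (\<Sum>k\<le>?d. fps_nth F k * coef (a ^ k) w) * coef (word_prod \<phi> w) m)"
    unfolding coef_subst_letters by (intro sum.cong refl) (simp add: coef_eval_fps_upto[OF a])
  also have "\<dots> = (\<Sum>k\<le>?d. fps_nth F k * (\<Sum>w\<in>words_upto ?d. coef (a ^ k) w * coef (word_prod \<phi> w) m))"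
    by (simp add: sum_distrib_left sum_distrib_right mult.assoc sum.swap[of _ "words_upto ?d"])
  also have "\<dots> = (\<Sum>k\<le>?d. fps_nth F k * coef (subst_letters \<phi> a ^ k) m)"
    by (simp add: coef_subst_letters subst_letters_power[OF ok, symmetric])
  also have "\<dots> = coef (eval_fps (subst_letters \<phi> a) F) m"
    by (simp add: coef_eval_fps)
  finally show "coef (subst_letters \<phi> (eval_fps a F)) m = coef (eval_fps (subst_letters \<phi> a) F) m" .
qed

lemma subst_letters_series_exp: "no_constant_terms \<phi> \<Longrightarrow> vanishes_below a 1 \<Longrightarrow> subst_letters \<phi> (series_exp a) = series_exp (subst_letters \<phi> a)"
  by (simp add: series_exp_def subst_letters_eval_fps)

lemma subst_letters_series_log1p: "no_constant_terms \<phi> \<Longrightarrow> vanishes_below a 1 \<Longrightarrow> subst_letters \<phi> (series_log1p a) = series_log1p (subst_letters \<phi> a)"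
  by (simp add: series_log1p_def subst_letters_eval_fps)

section \<open>The Dynkin-Specht-Wever lemma\<close>

text \<open>Series indexed by pairs of words model the tensor square of the free algebra:
  \<^term>\<open>left_letter a\<close> is \<open>a \<otimes> 1\<close> and \<^term>\<open>right_letter a\<close> is \<open>1 \<otimes> a\<close>.\<close>

type_synonym word_pair = "bool list \<times> bool list"

lemma zero_word_pair [simp]: "(0::'a list \<times> 'b list) = ([], [])"
  by (simp add: zero_prod_def)

definition left_letter :: "bool \<Rightarrow> word_pair series" where
  "left_letter a = Series (\<lambda>q. if q = ([a], []) then 1 else 0)"
definition right_letter :: "bool \<Rightarrow> word_pair series" where
  "right_letter a = Series (\<lambda>q. if q = ([], [a]) then 1 else 0)"

lemma coef_left_letter: "coef (left_letter a) q = (if q = ([a], []) then 1 else 0)"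
  by (simp add: left_letter_def)
lemma coef_right_letter: "coef (right_letter a) q = (if q = ([], [a]) then 1 else 0)"
  by (simp add: right_letter_def)

lemma coef_left_letter_mult:
  "coef (left_letter a * F) q = (if fst q \<noteq> [] \<and> hd (fst q) = a then coef F (tl (fst q), snd q) else 0)"
proof (cases "fst q \<noteq> [] \<and> hd (fst q) = a")
  case True
  then obtain u' v where q: "q = (a # u', v)" by (cases q; cases "fst q") auto
  have "coef (left_letter a * F) q = (\<Sum>p\<in>splittings q. (if p = (([a], []), (u', v)) then 1 else 0) * coef F (snd p))"
    unfolding coef_mult
  proof (intro sum.cong refl)
    fix p assume "p \<in> splittings q"
    then have "fst p + snd p = (a # u', v)" by (simp add: q)
    then show "coef (left_letter a) (fst p) * coef F (snd p) = (if p = (([a], []), (u', v)) then 1 else 0) * coef F (snd p)"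
      by (cases p) (auto simp: coef_left_letter)
  qed
  also have "\<dots> = coef F (u', v)"
    using sum_delta_mult[of "splittings q" "(([a], []), (u', v))" "\<lambda>p. coef F (snd p)"]
      by (simp add: q)
  finally show ?thesis by (simp add: q)
next
  case False
  have "coef (left_letter a) (fst p) * coef F (snd p) = 0" if "p \<in> splittings q" for p
    using that False by (cases p) (auto simp: coef_left_letter)
  then show ?thesis using False by (auto simp: coef_mult intro!: sum.neutral)
qed

lemma coef_right_letter_mult:
  "coef (right_letter a * F) q = (if snd q \<noteq> [] \<and> hd (snd q) = a then coef F (fst q, tl (snd q)) else 0)"
proof (cases "snd q \<noteq> [] \<and> hd (snd q) = a")
  case True
  then obtain u v' where q: "q = (u, a # v')" by (cases q; cases "snd q") auto
  have "coef (right_letter a * F) q = (\<Sum>p\<in>splittings q. (if p = (([], [a]), (u, v')) then 1 else 0) * coef F (snd p))"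
    unfolding coef_mult
  proof (intro sum.cong refl)
    fix p assume "p \<in> splittings q"
    then have "fst p + snd p = (u, a # v')" by (simp add: q)
    then show "coef (right_letter a) (fst p) * coef F (snd p) = (if p = (([], [a]), (u, v')) then 1 else 0) * coef F (snd p)"
      by (cases p) (auto simp: coef_right_letter)
  qed
  also have "\<dots> = coef F (u, v')"
    using sum_delta_mult[of "splittings q" "(([], [a]), (u, v'))" "\<lambda>p. coef F (snd p)"]
      by (simp add: q)
  finally show ?thesis by (simp add: q)
next
  case False
  have "coef (right_letter a) (fst p) * coef F (snd p) = 0" if "p \<in> splittings q" for p
    using that False by (cases p) (auto simp: coef_right_letter)
  then show ?thesis using False by (auto simp: coef_mult intro!: sum.neutral)
qed

lemma coef_left_letter_mult_pair [simp]:
  "coef (left_letter a * F) (u, v) = (if u \<noteq> [] \<and> hd u = a then coef F (tl u, v) else 0)"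
  using coef_left_letter_mult[of a F "(u, v)"] by simp

lemma coef_right_letter_mult_pair [simp]:
  "coef (right_letter a * F) (u, v) = (if v \<noteq> [] \<and> hd v = a then coef F (u, tl v) else 0)"
  using coef_right_letter_mult[of a F "(u, v)"] by simp

lemma coef_letter_mult:
  "coef (letter a * g) w = (if w \<noteq> [] \<and> hd w = a then coef g (tl w) else 0)"
proof (cases "w \<noteq> [] \<and> hd w = a")
  case True
  then obtain w' where w: "w = a # w'" by (cases w) auto
  have "coef (letter a * g) w = (\<Sum>p\<in>splittings w. (if p = ([a], w') then 1 else 0) * coef g (snd p))"
    unfolding coef_mult
  proof (intro sum.cong refl)
    fix p assume "p \<in> splittings w"
    then have "fst p @ snd p = a # w'" by (simp add: w)
    then show "coef (letter a) (fst p) * coef g (snd p) = (if p = ([a], w') then 1 else 0) * coef g (snd p)"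
      by (cases p) (auto simp: coef_letter Cons_eq_append_conv)
  qed
  also have "\<dots> = coef g w'"
    using sum_delta_mult[of "splittings w" "([a], w')" "\<lambda>p. coef g (snd p)"] by (simp add: w)
  finally show ?thesis by (simp add: w)
next
  case False
  have "coef (letter a) (fst p) * coef g (snd p) = 0" if "p \<in> splittings w" for p
    using that False by (cases p) (auto simp: coef_letter)
  then show ?thesis using False by (auto simp: coef_mult intro!: sum.neutral)
qed

lemma coef_mult_letter:
  "coef (g * letter a) w = (if w \<noteq> [] \<and> last w = a then coef g (butlast w) else 0)"
proof (cases "w \<noteq> [] \<and> last w = a")
  case True
  then obtain w' where w: "w = w' @ [a]" by (cases w rule: rev_exhaust) auto
  have "coef (g * letter a) w = (\<Sum>p\<in>splittings w. (if p = (w', [a]) then 1 else 0) * coef g (fst p))"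
    unfolding coef_mult
  proof (intro sum.cong refl)
    fix p assume "p \<in> splittings w"
    then have "fst p @ snd p = w' @ [a]" by (simp add: w)
    then show "coef g (fst p) * coef (letter a) (snd p) = (if p = (w', [a]) then 1 else 0) * coef g (fst p)"
      by (cases p) (auto simp: coef_letter append_eq_append_conv2 append_eq_Cons_conv)
  qed
  also have "\<dots> = coef g w'"
    using sum_delta_mult[of "splittings w" "(w', [a])" "\<lambda>p. coef g (fst p)"] by (simp add: w)
  finally show ?thesis by (simp add: w)
next
  case False
  have "coef g (fst p) * coef (letter a) (snd p) = 0" if "p \<in> splittings w" for p
    using that False by (cases p) (auto simp: coef_letter)
  then show ?thesis using False by (auto simp: coef_mult intro!: sum.neutral)
qed

lemma no_constant_terms_left_letter: "no_constant_terms left_letter"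
  by (simp add: no_constant_terms_def vanishes_below_def coef_left_letter grade_eq_0_iff)
lemma no_constant_terms_right_letter: "no_constant_terms right_letter"
  by (simp add: no_constant_terms_def vanishes_below_def coef_right_letter grade_eq_0_iff)

definition primitive_letter :: "bool \<Rightarrow> word_pair series" where
  "primitive_letter a = left_letter a + right_letter a"
lemma no_constant_terms_primitive_letter: "no_constant_terms primitive_letter"
  using no_constant_terms_left_letter no_constant_terms_right_letter
    by (simp add: no_constant_terms_def primitive_letter_def vanishes_below_add)

lemma word_prod_left_letter: "word_prod left_letter w = Series (\<lambda>q. if q = (w, []) then 1 else 0)"
proof (induct w)
  case Nil then show ?case by (rule series_eqI) auto
next
  case (Cons a w)
  show ?case
  proof (rule series_eqI)
    fix q :: word_pair
    obtain u v where q: "q = (u, v)" by (cases q)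
    show "coef (word_prod left_letter (a # w)) q = coef (Series (\<lambda>q. if q = (a # w, []) then 1 else 0)) q"
      by (cases u) (auto simp: coef_left_letter_mult Cons q)
  qed
qed

lemma word_prod_right_letter: "word_prod right_letter w = Series (\<lambda>q. if q = ([], w) then 1 else 0)"
proof (induct w)
  case Nil then show ?case by (rule series_eqI) auto
next
  case (Cons a w)
  show ?case
  proof (rule series_eqI)
    fix q :: word_pair
    obtain u v where q: "q = (u, v)" by (cases q)
    show "coef (word_prod right_letter (a # w)) q = coef (Series (\<lambda>q. if q = ([], a # w) then 1 else 0)) q"
      by (cases v) (auto simp: coef_right_letter_mult Cons q)
  qed
qed

definition embed_left :: "bool list series \<Rightarrow> word_pair series" where
  "embed_left = subst_letters left_letter"
definition embed_right :: "bool list series \<Rightarrow> word_pair series" where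
  "embed_right = subst_letters right_letter"
definition coproduct :: "bool list series \<Rightarrow> word_pair series" where
  "coproduct = subst_letters primitive_letter"

lemma coef_embed_left: "coef (embed_left f) q = (if snd q = [] then coef f (fst q) else 0)"
proof -
  have "coef (embed_left f) q = (\<Sum>w\<in>words_upto (grade q). coef f w * (if q = (w, []) then 1 else 0))"
    by (simp add: embed_left_def coef_subst_letters word_prod_left_letter)
  also have "\<dots> = (\<Sum>w\<in>words_upto (grade q). (if w = fst q \<and> snd q = [] then 1 else 0) * coef f w)"
    by (intro sum.cong refl) (cases q, auto)
  also have "\<dots> = (if snd q = [] then coef f (fst q) else 0)"
    by (cases q) (auto simp: sum_delta_mult)
  finally show ?thesis .
qed

lemma coef_embed_right: "coef (embed_right f) q = (if fst q = [] then coef f (snd q) else 0)"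
proof -
  have "coef (embed_right f) q = (\<Sum>w\<in>words_upto (grade q). coef f w * (if q = ([], w) then 1 else 0))"
    by (simp add: embed_right_def coef_subst_letters word_prod_right_letter)
  also have "\<dots> = (\<Sum>w\<in>words_upto (grade q). (if w = snd q \<and> fst q = [] then 1 else 0) * coef f w)"
    by (intro sum.cong refl) (cases q, auto)
  also have "\<dots> = (if fst q = [] then coef f (snd q) else 0)"
    by (cases q) (auto simp: sum_delta_mult)
  finally show ?thesis .
qed

lemma embed_left_right_commute: "embed_left f * embed_right g = embed_right g * embed_left f"
proof (rule series_eqI)
  fix q :: word_pair
  obtain u v where q: "q = (u, v)" by (cases q)
  have "coef (embed_left f * embed_right g) q = (\<Sum>p\<in>splittings q. (if p = ((u, []), ([], v)) then 1 else 0) * (coef f u * coef g v))"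
    unfolding coef_mult
    by (intro sum.cong refl) (auto simp: coef_embed_left coef_embed_right q)
  also have "\<dots> = coef f u * coef g v" by (rule sum_delta_mult) (auto simp: q)
  finally have 1: "coef (embed_left f * embed_right g) q = coef f u * coef g v" .
  have "coef (embed_right g * embed_left f) q = (\<Sum>p\<in>splittings q. (if p = (([], v), (u, [])) then 1 else 0) * (coef f u * coef g v))"
    unfolding coef_mult
    by (intro sum.cong refl) (auto simp: coef_embed_left coef_embed_right q)
  also have "\<dots> = coef f u * coef g v" by (rule sum_delta_mult) (auto simp: q)
  finally show "coef (embed_left f * embed_right g) q = coef (embed_right g * embed_left f) q"
    using 1 by simp
qed

fun commutator_word :: "(bool \<Rightarrow> 'a::ring) \<Rightarrow> bool list \<Rightarrow> 'a" where
  "commutator_word \<beta> [] = 0"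
| "commutator_word \<beta> [a] = \<beta> a"
| "commutator_word \<beta> (a # b # w) = \<beta> a * commutator_word \<beta> (b # w) - commutator_word \<beta> (b # w) * \<beta> a"

text \<open>\<^term>\<open>antipode_conv g\<close> is \<open>\<mu> \<circ> (g(deg) \<otimes> S)\<close>, where \<open>S v = (-1)\<^bsup>|v|\<^esup> rev v\<close> is the
  antipode of the free associative algebra with primitive letters.  For \<open>g i = i\<close> it maps the coproduct of a word
  to its right-nested commutator, while it multiplies \<open>Z \<otimes> 1\<close> by the degree and kills
  \<open>1 \<otimes> Z\<close>; this is the classical proof of the Dynkin-Specht-Wever lemma.\<close>

definition antipode_conv :: "(nat \<Rightarrow> real) \<Rightarrow> word_pair series \<Rightarrow> bool list series" where
  "antipode_conv g F =
     Series (\<lambda>w. \<Sum>i\<le>length w. g i * (-1) ^ (length w - i) * coef F (take i w, rev (drop i w)))"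

lemma coef_antipode_conv:
  "coef (antipode_conv g F) w =
     (\<Sum>i\<le>length w. g i * (-1) ^ (length w - i) * coef F (take i w, rev (drop i w)))"
  by (simp add: antipode_conv_def)

lemma antipode_conv_add: "antipode_conv g (F + G) = antipode_conv g F + antipode_conv g G"
  by (rule series_eqI) (simp add: coef_antipode_conv algebra_simps sum.distrib)

lemma antipode_conv_1: "antipode_conv g 1 = g 0 *\<^sub>R 1"
  by (rule series_eqI) (auto simp: coef_antipode_conv zero_prod_def intro!: sum.neutral)

lemma antipode_conv_left_letter:
  "antipode_conv g (left_letter a * F) = letter a * antipode_conv (\<lambda>i. g (Suc i)) F"
proof (rule series_eqI)
  fix w :: "bool list"
  show "coef (antipode_conv g (left_letter a * F)) w = coef (letter a * antipode_conv (\<lambda>i. g (Suc i)) F) w"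
  proof (cases w)
    case Nil
    then show ?thesis by (simp add: coef_antipode_conv coef_letter_mult)
  next
    case (Cons b w')
    let ?t = "\<lambda>i. g i * (-1) ^ (length w - i) * coef (left_letter a * F) (take i w, rev (drop i w))"
    have "coef (antipode_conv g (left_letter a * F)) w = ?t 0 + (\<Sum>j\<le>length w'. ?t (Suc j))"
      unfolding coef_antipode_conv by (simp only: Cons length_Cons sum.atMost_Suc_shift)
    also have "\<dots> = (\<Sum>j\<le>length w'. g (Suc j) * (-1) ^ (length w' - j) *
             (if b = a then coef F (take j w', rev (drop j w')) else 0))"
      by (cases "b = a") (simp_all add: Cons coef_left_letter_mult algebra_simps)
    also have "\<dots> = coef (letter a * antipode_conv (\<lambda>i. g (Suc i)) F) w"
      by (cases "b = a") (simp_all add: Cons coef_letter_mult coef_antipode_conv)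
    finally show ?thesis .
  qed
qed

lemma antipode_conv_right_letter:
  "antipode_conv g (right_letter a * F) = - (antipode_conv g F * letter a)"
proof (rule series_eqI)
  fix w :: "bool list"
  show "coef (antipode_conv g (right_letter a * F)) w = coef (- (antipode_conv g F * letter a)) w"
  proof (cases w rule: rev_exhaust)
    case Nil
    then show ?thesis by (simp add: coef_antipode_conv coef_mult_letter coef_right_letter_mult)
  next
    case (snoc w' b)
    let ?t = "\<lambda>i. g i * (-1) ^ (length w - i) * coef (right_letter a * F) (take i w, rev (drop i w))"
    have "coef (antipode_conv g (right_letter a * F)) w = (\<Sum>i\<le>length w'. ?t i) + ?t (Suc (length w'))"
      unfolding coef_antipode_conv by (simp only: snoc length_append_singleton sum.atMost_Suc)
    also have "?t (Suc (length w')) = 0"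
      by (simp add: snoc coef_right_letter_mult)
    also have "(\<Sum>i\<le>length w'. ?t i) = (\<Sum>i\<le>length w'. - (g i * (-1) ^ (length w' - i) *
             (if b = a then coef F (take i w', rev (drop i w')) else 0)))"
    proof (intro sum.cong refl)
      fix i assume "i \<in> {..length w'}"
      then have i: "i \<le> length w'" by simp
      then have "(-1::real) ^ (length w - i) = - ((-1) ^ (length w' - i))"
        by (simp add: snoc Suc_diff_le)
      with i show "?t i = - (g i * (-1) ^ (length w' - i) *
             (if b = a then coef F (take i w', rev (drop i w')) else 0))"
        by (simp add: snoc coef_right_letter_mult)
    qed
    also have "\<dots> + 0 = coef (- (antipode_conv g F * letter a)) w"
      by (cases "b = a") (simp_all add: snoc coef_mult_letter coef_antipode_conv sum_negf)
    finally show ?thesis .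
  qed
qed

lemma antipode_conv_coproduct_word:
  "antipode_conv (\<lambda>i. c + d * real i) (word_prod primitive_letter w) =
     (if w = [] then c *\<^sub>R 1 else d *\<^sub>R commutator_word letter w)"
proof (induct w arbitrary: c)
  case Nil
  then show ?case by (simp add: antipode_conv_1)
next
  case (Cons a w)
  have shift: "(\<lambda>i. c + d * (1 + real i)) = (\<lambda>i. (c + d) + d * real i)"
    by (simp add: algebra_simps)
  have "antipode_conv (\<lambda>i. c + d * real i) (word_prod primitive_letter (a # w)) =
      letter a * antipode_conv (\<lambda>i. (c + d) + d * real i) (word_prod primitive_letter w)
      - antipode_conv (\<lambda>i. c + d * real i) (word_prod primitive_letter w) * letter a"
    by (simp add: primitive_letter_def distrib_right antipode_conv_add antipode_conv_left_letter
        antipode_conv_right_letter shift)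
  also have "\<dots> = d *\<^sub>R commutator_word letter (a # w)"
    by (simp only: Cons) (cases w; simp add: algebra_simps)
  finally show ?case
    by simp
qed

lemma coef_antipode_conv_coproduct:
  "coef (antipode_conv real (coproduct Z)) v =
     (\<Sum>w\<in>words_upto (length v). coef Z w * coef (commutator_word letter w) v)"
proof -
  have "coef (antipode_conv real (coproduct Z)) v = (\<Sum>i\<le>length v. real i * (-1) ^ (length v - i) *
          (\<Sum>w\<in>words_upto (length v). coef Z w * coef (word_prod primitive_letter w) (take i v, rev (drop i v))))"
    unfolding coef_antipode_conv coproduct_def
    by (intro sum.cong refl) (simp add: coef_subst_letters)
  also have "\<dots> = (\<Sum>w\<in>words_upto (length v). coef Z w * (\<Sum>i\<le>length v. real i * (-1) ^ (length v - i) *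
          coef (word_prod primitive_letter w) (take i v, rev (drop i v))))"
    by (simp add: sum_distrib_left sum_distrib_right algebra_simps sum.swap[of _ "words_upto (length v)"])
  also have "\<dots> = (\<Sum>w\<in>words_upto (length v). coef Z w * coef (commutator_word letter w) v)"
  proof (intro sum.cong refl)
    fix w
    have "commutator_word letter w = antipode_conv real (word_prod primitive_letter w)"
      using antipode_conv_coproduct_word[of 0 1 w] by (cases "w = []") simp_all
    then show "coef Z w * (\<Sum>i\<le>length v. real i * (-1) ^ (length v - i) *
          coef (word_prod primitive_letter w) (take i v, rev (drop i v))) =
        coef Z w * coef (commutator_word letter w) v"
      by (simp add: coef_antipode_conv)
  qed
  finally show ?thesis .
qed

lemma coef_antipode_conv_embed_left:
  "coef (antipode_conv real (embed_left Z)) v = real (length v) * coef Z v"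
proof -
  have "coef (antipode_conv real (embed_left Z)) v =
      (\<Sum>i\<le>length v. if i = length v then real (length v) * coef Z v else 0)"
    unfolding coef_antipode_conv by (intro sum.cong refl) (auto simp: coef_embed_left)
  then show ?thesis by simp
qed

lemma coef_antipode_conv_embed_right: "coef (antipode_conv real (embed_right Z)) v = 0"
  unfolding coef_antipode_conv by (auto simp: coef_embed_right intro!: sum.neutral)

theorem dynkin_specht_wever:
  assumes "coproduct Z = embed_left Z + embed_right Z"
  shows "real (length v) * coef Z v =
    (\<Sum>w\<in>words_upto (length v). coef Z w * coef (commutator_word letter w) v)"
  using arg_cong[OF assms, of "\<lambda>F. coef (antipode_conv real F) v"]
  by (simp add: antipode_conv_add coef_antipode_conv_embed_left coef_antipode_conv_embed_right
      coef_antipode_conv_coproduct)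

lemma coef_series_exp_0: "coef (series_exp a) (0::'a::graded_monoid) = 1"
  by (simp add: series_exp_def coef_eval_fps)

lemma vanishes_below_letter: "vanishes_below (letter a) 1"
  by (simp add: vanishes_below_def coef_letter)

lemma embed_left_letter: "embed_left (letter a) = left_letter a"
  by (simp add: embed_left_def subst_letters_letter no_constant_terms_left_letter)
lemma embed_right_letter: "embed_right (letter a) = right_letter a"
  by (simp add: embed_right_def subst_letters_letter no_constant_terms_right_letter)
lemma coproduct_letter: "coproduct (letter a) = left_letter a + right_letter a"
  by (simp add: coproduct_def subst_letters_letter no_constant_terms_primitive_letter primitive_letter_def)

section \<open>The Baker-Campbell-Hausdorff series\<close>

definition exp_product :: "bool list series" where
  "exp_product = series_exp (letter True) * series_exp (letter False)"
definition bch_series :: "bool list series" where "bch_series = series_log1p (exp_product - 1)"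

lemma vanishes_below_exp_product_minus_1: "vanishes_below (exp_product - 1) 1"
  unfolding vanishes_below_1_iff
  using coef_mult_0[of "series_exp (letter True)" "series_exp (letter False)", simplified]
    coef_series_exp_0[of "letter True", simplified] coef_series_exp_0[of "letter False", simplified]
  by (simp add: exp_product_def)

lemma series_exp_bch_series: "series_exp bch_series = exp_product"
  unfolding bch_series_def using series_exp_log1p[OF vanishes_below_exp_product_minus_1] by simp

lemma vanishes_below_bch_series: "vanishes_below bch_series 1"
  unfolding bch_series_def by (rule vanishes_below_series_log1p)

lemma embed_left_series_exp: "vanishes_below a 1 \<Longrightarrow> embed_left (series_exp a) = series_exp (embed_left a)"
  by (simp add: embed_left_def subst_letters_series_exp no_constant_terms_left_letter)
lemma embed_right_series_exp: "vanishes_below a 1 \<Longrightarrow> embed_right (series_exp a) = series_exp (embed_right a)"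
  by (simp add: embed_right_def subst_letters_series_exp no_constant_terms_right_letter)
lemma coproduct_series_exp: "vanishes_below a 1 \<Longrightarrow> coproduct (series_exp a) = series_exp (coproduct a)"
  by (simp add: coproduct_def subst_letters_series_exp no_constant_terms_primitive_letter)

lemma vanishes_below_embed_left: "vanishes_below a 1 \<Longrightarrow> vanishes_below (embed_left a) 1"
  unfolding embed_left_def by (rule vanishes_below_subst_letters)
lemma vanishes_below_embed_right: "vanishes_below a 1 \<Longrightarrow> vanishes_below (embed_right a) 1"
  unfolding embed_right_def by (rule vanishes_below_subst_letters)

lemma coproduct_exp_product: "coproduct exp_product = embed_left exp_product * embed_right exp_product"
proof -
  have ex: "series_exp (left_letter a + right_letter a) = embed_left (series_exp (letter a)) * embed_right (series_exp (letter a))" for a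
  proof -
    have "series_exp (left_letter a + right_letter a) = series_exp (left_letter a) * series_exp (right_letter a)"
      by (rule series_exp_add_commuting) (use vanishes_below_embed_left[OF vanishes_below_letter] vanishes_below_embed_right[OF vanishes_below_letter] embed_left_right_commute
            in \<open>simp_all add: embed_left_letter[symmetric] embed_right_letter[symmetric]\<close>)
    then show ?thesis
      by (simp add: embed_left_series_exp[OF vanishes_below_letter] embed_right_series_exp[OF vanishes_below_letter] embed_left_letter embed_right_letter)
  qed
  have "coproduct exp_product = coproduct (series_exp (letter True)) * coproduct (series_exp (letter False))"
    by (simp add: exp_product_def coproduct_def subst_letters_mult no_constant_terms_primitive_letter)
  also have "\<dots> = embed_left (series_exp (letter True)) * embed_right (series_exp (letter True)) * (embed_left (series_exp (letter False)) * embed_right (series_exp (letter False)))"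
    by (simp add: coproduct_series_exp[OF vanishes_below_letter] coproduct_letter ex)
  also have "\<dots> = embed_left (series_exp (letter True)) * (embed_right (series_exp (letter True)) * embed_left (series_exp (letter False))) * embed_right (series_exp (letter False))"
    by (simp add: mult.assoc)
  also have "\<dots> = embed_left (series_exp (letter True)) * (embed_left (series_exp (letter False)) * embed_right (series_exp (letter True))) * embed_right (series_exp (letter False))"
    by (simp add: embed_left_right_commute)
  also have "\<dots> = embed_left exp_product * embed_right exp_product"
    by (simp add: exp_product_def embed_left_def embed_right_def subst_letters_mult no_constant_terms_left_letter no_constant_terms_right_letter mult.assoc)
  finally show ?thesis .
qed

lemma bch_series_primitive: "coproduct bch_series = embed_left bch_series + embed_right bch_series"
proof -
  have o1: "vanishes_below (embed_left bch_series) 1" "vanishes_below (embed_right bch_series) 1"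
    using vanishes_below_embed_left[OF vanishes_below_bch_series] vanishes_below_embed_right[OF vanishes_below_bch_series] by simp_all
  have "embed_left exp_product = series_exp (embed_left bch_series)"
    by (simp add: series_exp_bch_series[symmetric] embed_left_series_exp[OF vanishes_below_bch_series])
  moreover have "embed_right exp_product = series_exp (embed_right bch_series)"
    by (simp add: series_exp_bch_series[symmetric] embed_right_series_exp[OF vanishes_below_bch_series])
  ultimately have "coproduct exp_product = series_exp (embed_left bch_series) * series_exp (embed_right bch_series)"
    by (simp add: coproduct_exp_product)
  also have "\<dots> = series_exp (embed_left bch_series + embed_right bch_series)"
    by (rule series_exp_add_commuting[symmetric]) (use o1 embed_left_right_commute in auto)
  finally have e: "coproduct exp_product = series_exp (embed_left bch_series + embed_right bch_series)" .
  have "coproduct bch_series = series_log1p (coproduct (exp_product - 1))"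
    by (simp add: bch_series_def coproduct_def subst_letters_series_log1p[OF no_constant_terms_primitive_letter vanishes_below_exp_product_minus_1])
  also have "\<dots> = series_log1p (series_exp (embed_left bch_series + embed_right bch_series) - 1)"
    by (simp add: coproduct_def subst_letters_diff subst_letters_1 e[unfolded coproduct_def])
  also have "\<dots> = embed_left bch_series + embed_right bch_series"
    by (rule series_log1p_exp) (use o1 in \<open>simp add: vanishes_below_add\<close>)
  finally show ?thesis .
qed

definition homogeneous :: "bool list series \<Rightarrow> nat \<Rightarrow> bool" where
  "homogeneous f n \<longleftrightarrow> (\<forall>v. coef f v \<noteq> 0 \<longrightarrow> length v = n)"

lemma homogeneous_mult: "homogeneous f n \<Longrightarrow> homogeneous g m \<Longrightarrow> homogeneous (f * g) (n + m)"
  unfolding homogeneous_def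
proof (intro allI impI)
  fix v assume hf: "\<forall>v. coef f v \<noteq> 0 \<longrightarrow> length v = n" and hg: "\<forall>v. coef g v \<noteq> 0 \<longrightarrow> length v = m"
    and "coef (f * g) v \<noteq> 0"
  then obtain p where p: "p \<in> splittings v" "coef f (fst p) * coef g (snd p) \<noteq> 0"
    by (auto simp: coef_mult elim: sum.not_neutral_contains_not_neutral)
  then show "length v = n + m" using hf hg by (cases p) auto
qed

lemma homogeneous_diff: "homogeneous f n \<Longrightarrow> homogeneous g n \<Longrightarrow> homogeneous (f - g) n"
  unfolding homogeneous_def
proof (intro allI impI)
  fix v assume "\<forall>v. coef f v \<noteq> 0 \<longrightarrow> length v = n" "\<forall>v. coef g v \<noteq> 0 \<longrightarrow> length v = n"
    "coef (f - g) v \<noteq> 0"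
  moreover then have "coef f v \<noteq> 0 \<or> coef g v \<noteq> 0" by auto
  ultimately show "length v = n" by blast
qed

lemma homogeneous_letter: "homogeneous (letter a) 1"
  unfolding homogeneous_def by (simp add: coef_letter)

lemma homogeneous_commutator_word: "w \<noteq> [] \<Longrightarrow> homogeneous (commutator_word letter w) (length w)"
proof (induct w rule: induct_list012)
  case 1 then show ?case by simp
next
  case (2 a) then show ?case using homogeneous_letter by simp
next
  case (3 a b w)
  then have h: "homogeneous (commutator_word letter (b # w)) (length (b # w))" by simp
  show ?case
    using homogeneous_mult[OF homogeneous_letter h] homogeneous_mult[OF h homogeneous_letter]
    by (simp add: homogeneous_diff add.commute)
qed

lemma length_eq_if_coef_commutator_word: "coef (commutator_word letter w) v \<noteq> 0 \<Longrightarrow> length v = length w"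
  by (cases "w = []") (use homogeneous_commutator_word in \<open>auto simp: homogeneous_def\<close>)

lemma coef_bch_series_eq_sum_commutator_word:
  assumes "length v \<le> N"
  shows "coef bch_series v = (\<Sum>w\<in>words_upto N. (coef bch_series w / real (length w)) * coef (commutator_word letter w) v)"
proof (cases "v = []")
  case True
  have "coef bch_series v = 0"
    using vanishes_belowD[OF vanishes_below_bch_series, of "[]"] True by simp
  moreover have "(coef bch_series w / real (length w)) * coef (commutator_word letter w) v = 0" for w
    using length_eq_if_coef_commutator_word[of w v] True by (cases w) auto
  then have "(\<Sum>w\<in>words_upto N. (coef bch_series w / real (length w)) * coef (commutator_word letter w) v) = 0"
    by (intro sum.neutral) auto
  ultimately show ?thesis by simp
next
  case False
  have "(\<Sum>w\<in>words_upto N. (coef bch_series w / real (length w)) * coef (commutator_word letter w) v) =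
        (\<Sum>w\<in>words_upto N. (coef bch_series w * coef (commutator_word letter w) v) / real (length v))"
  proof (intro sum.cong refl)
    fix w
    show "(coef bch_series w / real (length w)) * coef (commutator_word letter w) v = (coef bch_series w * coef (commutator_word letter w) v) / real (length v)"
    proof (cases "coef (commutator_word letter w) v = 0")
      case True then show ?thesis by simp
    next
      case False then have "length v = length w" by (rule length_eq_if_coef_commutator_word)
      then show ?thesis by simp
    qed
  qed
  also have "\<dots> = (\<Sum>w\<in>words_upto (length v). coef bch_series w * coef (commutator_word letter w) v) / real (length v)"
    unfolding sum_divide_distrib[symmetric]
    by (rule arg_cong[where f="\<lambda>x. x / _"], rule sum.mono_neutral_right)
       (use assms length_eq_if_coef_commutator_word in auto)
  also have "\<dots> = coef bch_series v"
  proof -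
    have "real (length v) \<noteq> 0" using False by simp
    then show ?thesis
      using dynkin_specht_wever[OF bch_series_primitive, of v] by (simp add: field_simps)
  qed
  finally show ?thesis by simp
qed

section \<open>Dynkin's formula\<close>

lemma letter_power: "letter a ^ k = Series (\<lambda>w. if w = replicate k a then 1 else 0)"
proof (induct k)
  case 0 then show ?case by (rule series_eqI) auto
next
  case (Suc k)
  show ?case
  proof (rule series_eqI)
    fix w :: "bool list"
    show "coef (letter a ^ Suc k) w = coef (Series (\<lambda>w. if w = replicate (Suc k) a then 1 else 0)) w"
      by (cases w) (auto simp: coef_letter_mult Suc)
  qed
qed

lemma coef_series_exp_letter:
  "coef (series_exp (letter a)) w = (if w = replicate (length w) a then 1 / fact (length w) else 0)"
proof -
  have "coef (series_exp (letter a)) w = (\<Sum>k\<le>length w. (if k = length w then (if w = replicate (length w) a then 1 / fact (length w) else 0) else 0))"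
    unfolding series_exp_def coef_eval_fps letter_power
    by (intro sum.cong refl) (auto simp: divide_simps)
  then show ?thesis by simp
qed

definition block_word :: "nat \<Rightarrow> nat \<Rightarrow> bool list" where
  "block_word r s = replicate r True @ replicate s False"

lemma length_block_word [simp]: "length (block_word r s) = r + s" by (simp add: block_word_def)

lemma block_word_inj: "block_word i j = block_word r s \<Longrightarrow> i = r \<and> j = s"
proof -
  assume h: "block_word i j = block_word r s"
  have "length (filter (\<lambda>x. x) (block_word i j)) = i" "length (filter Not (block_word i j)) = j"
    by (simp_all add: block_word_def filter_replicate)
  moreover have "length (filter (\<lambda>x. x) (block_word r s)) = r" "length (filter Not (block_word r s)) = s"
    by (simp_all add: block_word_def filter_replicate)
  ultimately show ?thesis using h by metis
qed

lemma block_word_eq_Nil_iff: "block_word r s = [] \<longleftrightarrow> r = 0 \<and> s = 0" by (simp add: block_word_def)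

lemma coef_exp_product_block_word: "coef exp_product (block_word r s) = 1 / (fact r * fact s)"
proof -
  have "coef exp_product (block_word r s) = (\<Sum>p\<in>splittings (block_word r s). coef (series_exp (letter True)) (fst p) * coef (series_exp (letter False)) (snd p))"
    by (simp add: exp_product_def coef_mult)
  also have "\<dots> = (\<lambda>p. coef (series_exp (letter True)) (fst p) * coef (series_exp (letter False)) (snd p)) (replicate r True, replicate s False)"
  proof (rule sum_eq_single_term)
    show "(replicate r True, replicate s False) \<in> splittings (block_word r s)"
      by (simp add: block_word_def)
  next
    fix p assume p: "p \<in> splittings (block_word r s)" "p \<noteq> (replicate r True, replicate s False)"
    show "coef (series_exp (letter True)) (fst p) * coef (series_exp (letter False)) (snd p) = 0"
    proof (rule ccontr)
      assume "coef (series_exp (letter True)) (fst p) * coef (series_exp (letter False)) (snd p) \<noteq> 0"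
      then have 1: "fst p = replicate (length (fst p)) True" and 2: "snd p = replicate (length (snd p)) False"
        by (auto simp: coef_series_exp_letter split: if_splits)
      then have "block_word (length (fst p)) (length (snd p)) = block_word r s"
        using p(1) by (simp add: block_word_def)
      then have "length (fst p) = r" "length (snd p) = s" using block_word_inj by blast+
      then show False using p(2) 1 2 by (cases p) auto
    qed
  qed simp
  also have "\<dots> = 1 / (fact r * fact s)" by (simp add: coef_series_exp_letter)
  finally show ?thesis .
qed

lemma coef_exp_product_not_block_word: "(\<And>r s. u \<noteq> block_word r s) \<Longrightarrow> coef exp_product u = 0"
proof -
  assume nb: "\<And>r s. u \<noteq> block_word r s"
  have "coef (series_exp (letter True)) (fst p) * coef (series_exp (letter False)) (snd p) = 0" if "p \<in> splittings u" for p
  proof (rule ccontr)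
    assume "coef (series_exp (letter True)) (fst p) * coef (series_exp (letter False)) (snd p) \<noteq> 0"
    then have "fst p = replicate (length (fst p)) True" "snd p = replicate (length (snd p)) False"
      by (auto simp: coef_series_exp_letter split: if_splits)
    then have "u = block_word (length (fst p)) (length (snd p))"
      using that by (simp add: block_word_def)
    then show False using nb by blast
  qed
  then show ?thesis by (auto simp: exp_product_def coef_mult intro!: sum.neutral)
qed

text \<open>The words with nonzero coefficient in \<^term>\<open>exp_product\<close> are the blocks \<open>X\<^sup>r Y\<^sup>s\<close>, and
  a list of exponent pairs indexes a product of blocks, as in the definition of
  \<^const>\<open>bch\<close>.\<close>

definition exponent_pairs :: "nat \<Rightarrow> (nat \<times> nat) set" where
  "exponent_pairs m = ({0..m} \<times> {0..m}) - {(0, 0)}"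

lemma finite_exponent_pairs [simp]: "finite (exponent_pairs m)" by (simp add: exponent_pairs_def)

lemma coef_exp_product_minus_1_outside_blocks:
  assumes "length u \<le> m" "u \<notin> (\<lambda>q. block_word (fst q) (snd q)) ` exponent_pairs m"
  shows "coef (exp_product - 1) u = 0"
proof (cases "u = []")
  case True
  then show ?thesis
    using vanishes_belowD[OF vanishes_below_exp_product_minus_1, of "[]"] by simp
next
  case False
  have "u \<noteq> block_word r s" for r s
  proof
    assume u: "u = block_word r s"
    then have "(r, s) \<in> exponent_pairs m"
      using assms(1) False by (auto simp: exponent_pairs_def block_word_eq_Nil_iff)
    then show False
      using assms(2) u by force
  qed
  then show ?thesis
    using False by (simp add: coef_exp_product_not_block_word)
qed

lemma sum_words_upto_exp_product_minus_1:
  fixes h :: "bool list \<Rightarrow> 'v::real_vector"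
  assumes h: "\<And>u. length u > m \<Longrightarrow> h u = 0"
  shows "(\<Sum>u\<in>words_upto m. coef (exp_product - 1) u *\<^sub>R h u) =
    (\<Sum>q\<in>exponent_pairs m. (1 / (fact (fst q) * fact (snd q))) *\<^sub>R h (block_word (fst q) (snd q)))"
proof -
  let ?B = "(\<lambda>q. block_word (fst q) (snd q)) ` exponent_pairs m"
  have inj: "inj_on (\<lambda>q. block_word (fst q) (snd q)) (exponent_pairs m)"
    by (rule inj_onI) (metis block_word_inj prod.collapse)
  have "(\<Sum>u\<in>words_upto m. coef (exp_product - 1) u *\<^sub>R h u) =
      (\<Sum>u\<in>words_upto m \<union> ?B. coef (exp_product - 1) u *\<^sub>R h u)"
    by (rule sum.mono_neutral_left) (use h in auto)
  also have "\<dots> = (\<Sum>u\<in>?B. coef (exp_product - 1) u *\<^sub>R h u)"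
  proof (rule sum.mono_neutral_right)
    show "\<forall>u\<in>words_upto m \<union> ?B - ?B. coef (exp_product - 1) u *\<^sub>R h u = 0"
      using coef_exp_product_minus_1_outside_blocks[of _ m] by auto
  qed auto
  also have "\<dots> = (\<Sum>q\<in>exponent_pairs m.
      coef (exp_product - 1) (block_word (fst q) (snd q)) *\<^sub>R h (block_word (fst q) (snd q)))"
    by (rule sum.reindex[OF inj, unfolded comp_def])
  also have "\<dots> = (\<Sum>q\<in>exponent_pairs m.
      (1 / (fact (fst q) * fact (snd q))) *\<^sub>R h (block_word (fst q) (snd q)))"
  proof (intro sum.cong refl)
    fix q assume "q \<in> exponent_pairs m"
    then have "block_word (fst q) (snd q) \<noteq> []"
      by (cases q) (auto simp: exponent_pairs_def block_word_eq_Nil_iff)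
    then show "coef (exp_product - 1) (block_word (fst q) (snd q)) *\<^sub>R h (block_word (fst q) (snd q)) =
       (1 / (fact (fst q) * fact (snd q))) *\<^sub>R h (block_word (fst q) (snd q))"
      by (simp add: coef_exp_product_block_word)
  qed
  finally show ?thesis .
qed

definition exponent_lists :: "nat \<Rightarrow> nat \<Rightarrow> (nat \<times> nat) list set" where
  "exponent_lists m n = {rs. length rs = n \<and> set rs \<subseteq> exponent_pairs m}"

lemma finite_exponent_lists [simp]: "finite (exponent_lists m n)"
proof -
  have "exponent_lists m n \<subseteq> {rs. set rs \<subseteq> exponent_pairs m \<and> length rs \<le> n}"
    by (auto simp: exponent_lists_def)
  then show ?thesis by (rule finite_subset) (simp add: finite_lists_length_le)
qed

definition inverse_fact_prod :: "(nat \<times> nat) list \<Rightarrow> real" where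
  "inverse_fact_prod rs = prod_list (map (\<lambda>q. 1 / (fact (fst q) * fact (snd q))) rs)"

lemma dynkin_word_Cons: "dynkin_word (q # rs) = block_word (fst q) (snd q) @ dynkin_word rs"
  by (cases q) (simp add: dynkin_word_def block_word_def)

lemma dynkin_word_Nil: "dynkin_word [] = []" by (simp add: dynkin_word_def)

lemma exponent_lists_Suc: "exponent_lists m (Suc k) = (\<lambda>(q, rs). q # rs) ` (exponent_pairs m \<times> exponent_lists m k)"
proof (rule set_eqI)
  fix rs
  show "rs \<in> exponent_lists m (Suc k) \<longleftrightarrow> rs \<in> (\<lambda>(q, rs). q # rs) ` (exponent_pairs m \<times> exponent_lists m k)"
    by (cases rs) (auto simp: exponent_lists_def image_iff)
qed

lemma exponent_lists_0: "exponent_lists m 0 = {[]}" by (auto simp: exponent_lists_def)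

lemma sum_words_upto_exp_product_minus_1_power:
  fixes \<Psi> :: "bool list \<Rightarrow> 'v::real_vector"
  assumes "\<And>u. length u > m \<Longrightarrow> \<Psi> u = 0"
  shows "(\<Sum>w\<in>words_upto m. coef ((exp_product - 1) ^ k) w *\<^sub>R \<Psi> w) = (\<Sum>rs\<in>exponent_lists m k. inverse_fact_prod rs *\<^sub>R \<Psi> (dynkin_word rs))"
  using assms
proof (induct k arbitrary: \<Psi>)
  case 0
  have "(\<Sum>w\<in>words_upto m. coef ((exp_product - 1) ^ 0) w *\<^sub>R \<Psi> w) = (\<Sum>w\<in>words_upto m. (if w = [] then 1 else 0) *\<^sub>R \<Psi> w)"
    by simp
  also have "\<dots> = \<Psi> []" by (subst sum_eq_single_term[where a="[]"]) auto
  finally show ?case by (simp add: exponent_lists_0 inverse_fact_prod_def dynkin_word_Nil)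
next
  case (Suc k)
  let ?G = "exp_product - 1"
  have "(\<Sum>w\<in>words_upto m. coef (?G ^ Suc k) w *\<^sub>R \<Psi> w) =
        (\<Sum>w\<in>words_upto m. \<Sum>p\<in>splittings w. (coef ?G (fst p) * coef (?G ^ k) (snd p)) *\<^sub>R \<Psi> (fst p @ snd p))"
    by (intro sum.cong refl) (simp add: coef_mult scaleR_sum_left)
  also have "\<dots> = (\<Sum>u\<in>words_upto m. \<Sum>v\<in>words_upto m. if length u + length v \<le> m then (coef ?G u * coef (?G ^ k) v) *\<^sub>R \<Psi> (u @ v) else 0)"
    by (rule sum_words_upto_splittings)
  also have "\<dots> = (\<Sum>u\<in>words_upto m. coef ?G u *\<^sub>R (\<Sum>v\<in>words_upto m. coef (?G ^ k) v *\<^sub>R \<Psi> (u @ v)))"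
    unfolding scaleR_sum_right by (intro sum.cong refl) (auto simp: Suc.prems)
  also have "\<dots> = (\<Sum>u\<in>words_upto m. coef ?G u *\<^sub>R (\<Sum>rs\<in>exponent_lists m k. inverse_fact_prod rs *\<^sub>R \<Psi> (u @ dynkin_word rs)))"
    by (intro sum.cong refl arg_cong[where f="\<lambda>x. _ *\<^sub>R x"] Suc.hyps) (simp add: Suc.prems)
  also have "\<dots> = (\<Sum>rs\<in>exponent_lists m k. inverse_fact_prod rs *\<^sub>R (\<Sum>u\<in>words_upto m. coef ?G u *\<^sub>R \<Psi> (u @ dynkin_word rs)))"
    by (simp add: scaleR_sum_right sum.swap[of _ "words_upto m"] scaleR_scaleR mult.commute)
  also have "\<dots> = (\<Sum>rs\<in>exponent_lists m k. inverse_fact_prod rs *\<^sub>R (\<Sum>q\<in>exponent_pairs m. (1 / (fact (fst q) * fact (snd q))) *\<^sub>R \<Psi> (block_word (fst q) (snd q) @ dynkin_word rs)))"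
    by (intro sum.cong refl arg_cong[where f="\<lambda>x. _ *\<^sub>R x"] sum_words_upto_exp_product_minus_1) (simp add: Suc.prems)
  also have "\<dots> = (\<Sum>z\<in>exponent_pairs m \<times> exponent_lists m k. inverse_fact_prod (fst z # snd z) *\<^sub>R \<Psi> (dynkin_word (fst z # snd z)))"
    apply (simp add: scaleR_sum_right inverse_fact_prod_def dynkin_word_Cons scaleR_scaleR mult.commute)
    apply (subst sum.swap)
    apply (simp add: sum.cartesian_product split_beta)
    done
  also have "\<dots> = (\<Sum>rs\<in>exponent_lists m (Suc k). inverse_fact_prod rs *\<^sub>R \<Psi> (dynkin_word rs))"
    unfolding exponent_lists_Suc
    by (subst sum.reindex) (auto simp: inj_on_def split_beta)
  finally show ?case .
qed

lemma length_dynkin_word: "length (dynkin_word rs) = sum_list (map (\<lambda>(r, s). r + s) rs)"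
  by (induct rs) (auto simp: dynkin_word_Nil dynkin_word_Cons split: prod.splits)

lemma inverse_fact_prod_eq: "inverse_fact_prod rs = 1 / prod_list (map (\<lambda>(r, s). fact r * fact s) rs)"
  by (induct rs) (auto simp: inverse_fact_prod_def split: prod.splits)

lemma coef_bch_series_eq_log_sum:
  assumes "length w \<le> m"
  shows "coef bch_series w = (\<Sum>n\<in>{1..m}. ((-1) ^ (n - 1) / real n) * coef ((exp_product - 1) ^ n) w)"
proof -
  have "coef bch_series w = (\<Sum>k\<le>m. fps_nth (fps_ln 1) k * coef ((exp_product - 1) ^ k) w)"
    unfolding bch_series_def series_log1p_def
    by (rule coef_eval_fps_upto[OF vanishes_below_exp_product_minus_1]) (use assms in simp)
  also have "\<dots> = (\<Sum>k\<in>insert 0 {1..m}. fps_nth (fps_ln 1) k * coef ((exp_product - 1) ^ k) w)"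
    by (rule sum.cong) auto
  also have "\<dots> = (\<Sum>n\<in>{1..m}. ((-1) ^ (n - 1) / real n) * coef ((exp_product - 1) ^ n) w)"
    by (simp add: fps_ln_nth)
  finally show ?thesis .
qed

lemma sum_dynkin_words:
  fixes \<Phi> :: "bool list \<Rightarrow> 'v::real_vector"
  assumes \<Phi>: "\<And>u. length u > m \<Longrightarrow> \<Phi> u = 0"
  shows "(\<Sum>rs\<in>{rs. length rs = n \<and> set rs \<subseteq> ({0..m} \<times> {0..m}) - {(0, 0)}}.
           (1 / (real (sum_list (map (\<lambda>(r, s). r + s) rs)) *
                 prod_list (map (\<lambda>(r, s). fact r * fact s) rs))) *\<^sub>R \<Phi> (dynkin_word rs))
    = (\<Sum>w\<in>words_upto m. coef ((exp_product - 1) ^ n) w *\<^sub>R ((1 / real (length w)) *\<^sub>R \<Phi> w))"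
proof -
  have "(\<Sum>rs\<in>{rs. length rs = n \<and> set rs \<subseteq> ({0..m} \<times> {0..m}) - {(0, 0)}}.
           (1 / (real (sum_list (map (\<lambda>(r, s). r + s) rs)) *
                 prod_list (map (\<lambda>(r, s). fact r * fact s) rs))) *\<^sub>R \<Phi> (dynkin_word rs))
    = (\<Sum>rs\<in>exponent_lists m n. inverse_fact_prod rs *\<^sub>R ((1 / real (length (dynkin_word rs))) *\<^sub>R \<Phi> (dynkin_word rs)))"
    unfolding exponent_lists_def exponent_pairs_def
    by (intro sum.cong refl) (simp add: inverse_fact_prod_eq length_dynkin_word)
  also have "\<dots> = (\<Sum>w\<in>words_upto m. coef ((exp_product - 1) ^ n) w *\<^sub>R ((1 / real (length w)) *\<^sub>R \<Phi> w))"
    by (rule sum_words_upto_exp_product_minus_1_power[symmetric]) (simp add: \<Phi>)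
  finally show ?thesis .
qed

lemma bch_eq_sum_bch_series:
  fixes \<Phi> :: "bool list \<Rightarrow> 'v::real_vector"
  assumes \<Phi>: "\<And>u. length u > m \<Longrightarrow> \<Phi> u = 0"
  shows "(\<Sum>n\<in>{1..m}. ((-1) ^ (n - 1) / real n) *\<^sub>R
        (\<Sum>rs\<in>{rs. length rs = n \<and> set rs \<subseteq> ({0..m} \<times> {0..m}) - {(0, 0)}}.
           (1 / (real (sum_list (map (\<lambda>(r, s). r + s) rs)) *
                 prod_list (map (\<lambda>(r, s). fact r * fact s) rs))) *\<^sub>R
           \<Phi> (dynkin_word rs)))
   = (\<Sum>w\<in>words_upto m. (coef bch_series w / real (length w)) *\<^sub>R \<Phi> w)"
proof -
  define \<Psi> where "\<Psi> w = (1 / real (length w)) *\<^sub>R \<Phi> w" for w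
  let ?c = "\<lambda>n w. ((-1) ^ (n - 1) / real n) * coef ((exp_product - 1) ^ n) w"
  have "(\<Sum>n\<in>{1..m}. ((-1) ^ (n - 1) / real n) *\<^sub>R
        (\<Sum>rs\<in>{rs. length rs = n \<and> set rs \<subseteq> ({0..m} \<times> {0..m}) - {(0, 0)}}.
           (1 / (real (sum_list (map (\<lambda>(r, s). r + s) rs)) *
                 prod_list (map (\<lambda>(r, s). fact r * fact s) rs))) *\<^sub>R
           \<Phi> (dynkin_word rs)))
    = (\<Sum>n\<in>{1..m}. ((-1) ^ (n - 1) / real n) *\<^sub>R
        (\<Sum>w\<in>words_upto m. coef ((exp_product - 1) ^ n) w *\<^sub>R \<Psi> w))"
    unfolding \<Psi>_def using sum_dynkin_words[where \<Phi> = \<Phi> and m = m, OF \<Phi>] by simp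
  also have "\<dots> = (\<Sum>w\<in>words_upto m. (\<Sum>n\<in>{1..m}. ?c n w) *\<^sub>R \<Psi> w)"
    by (simp only: scaleR_sum_right scaleR_scaleR scaleR_sum_left) (rule sum.swap)
  also have "\<dots> = (\<Sum>w\<in>words_upto m. (coef bch_series w / real (length w)) *\<^sub>R \<Phi> w)"
    by (intro sum.cong refl) (simp add: coef_bch_series_eq_log_sum \<Psi>_def)
  finally show ?thesis .
qed

section \<open>Evaluation in algebras with nilpotent letters\<close>

definition nilpotent_letters :: "(bool \<Rightarrow> 'A::real_algebra_1) \<Rightarrow> nat \<Rightarrow> bool" where
  "nilpotent_letters \<beta> m \<longleftrightarrow> (\<forall>w. length w > m \<longrightarrow> word_prod \<beta> w = 0)"

definition eval_series :: "(bool \<Rightarrow> 'A::real_algebra_1) \<Rightarrow> nat \<Rightarrow> bool list series \<Rightarrow> 'A" where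
  "eval_series \<beta> m f = (\<Sum>w\<in>words_upto m. coef f w *\<^sub>R word_prod \<beta> w)"

lemma eval_series_add: "eval_series \<beta> m (f + g) = eval_series \<beta> m f + eval_series \<beta> m g"
  by (simp add: eval_series_def scaleR_add_left sum.distrib)

lemma eval_series_diff: "eval_series \<beta> m (f - g) = eval_series \<beta> m f - eval_series \<beta> m g"
  by (simp add: eval_series_def scaleR_diff_left sum_subtractf)

lemma eval_series_scaleR: "eval_series \<beta> m (c *\<^sub>R f) = c *\<^sub>R eval_series \<beta> m f"
  by (simp add: eval_series_def scaleR_sum_right)

lemma eval_series_1: "eval_series \<beta> m 1 = 1"
proof -
  have "eval_series \<beta> m 1 = (\<Sum>w\<in>words_upto m. (if w = [] then 1 else 0) *\<^sub>R word_prod \<beta> w)"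
    by (simp add: eval_series_def)
  also have "\<dots> = (if [] = ([]::bool list) then 1 else 0) *\<^sub>R word_prod \<beta> []"
    by (rule sum_eq_single_term) auto
  finally show ?thesis by simp
qed

lemma eval_series_0: "eval_series \<beta> m 0 = 0" by (simp add: eval_series_def)

lemma eval_series_letter: "m \<ge> 1 \<Longrightarrow> eval_series \<beta> m (letter a) = \<beta> a"
proof -
  assume m: "m \<ge> 1"
  have "eval_series \<beta> m (letter a) = (\<Sum>w\<in>words_upto m. (if w = [a] then 1 else 0) *\<^sub>R word_prod \<beta> w)"
    by (simp add: eval_series_def coef_letter)
  also have "\<dots> = (if [a] = [a] then 1 else 0) *\<^sub>R word_prod \<beta> [a]"
    by (rule sum_eq_single_term) (use m in auto)
  finally show ?thesis by simp
qed

lemma eval_series_mult: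
  assumes nil: "nilpotent_letters \<beta> m"
  shows "eval_series \<beta> m (f * g) = eval_series \<beta> m f * eval_series \<beta> m g"
proof -
  have "eval_series \<beta> m f * eval_series \<beta> m g = (\<Sum>u\<in>words_upto m. \<Sum>v\<in>words_upto m. (coef f u * coef g v) *\<^sub>R word_prod \<beta> (u @ v))"
    by (simp add: eval_series_def sum_product word_prod_append mult.commute)
  also have "\<dots> = (\<Sum>u\<in>words_upto m. \<Sum>v\<in>words_upto m. if length u + length v \<le> m then (coef f u * coef g v) *\<^sub>R word_prod \<beta> (u @ v) else 0)"
    by (intro sum.cong refl) (use nil in \<open>auto simp: nilpotent_letters_def\<close>)
  also have "\<dots> = (\<Sum>w\<in>words_upto m. \<Sum>p\<in>splittings w. (coef f (fst p) * coef g (snd p)) *\<^sub>R word_prod \<beta> (fst p @ snd p))"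
    by (rule sum_words_upto_splittings[symmetric])
  also have "\<dots> = eval_series \<beta> m (f * g)"
    by (simp add: eval_series_def coef_mult scaleR_sum_left)
  finally show ?thesis by simp
qed

lemma eval_series_power: "nilpotent_letters \<beta> m \<Longrightarrow> eval_series \<beta> m (f ^ k) = eval_series \<beta> m f ^ k"
  by (induct k) (simp_all add: eval_series_1 eval_series_mult)

definition fps_eval_upto :: "nat \<Rightarrow> 'A::real_algebra_1 \<Rightarrow> real fps \<Rightarrow> 'A" where
  "fps_eval_upto m A F = (\<Sum>k\<le>m. fps_nth F k *\<^sub>R A ^ k)"

lemma eval_series_eval_fps:
  assumes nil: "nilpotent_letters \<beta> m" and a: "vanishes_below a 1"
  shows "eval_series \<beta> m (eval_fps a F) = fps_eval_upto m (eval_series \<beta> m a) F"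
proof -
  have "eval_series \<beta> m (eval_fps a F) = (\<Sum>w\<in>words_upto m. (\<Sum>k\<le>m. fps_nth F k * coef (a ^ k) w) *\<^sub>R word_prod \<beta> w)"
    unfolding eval_series_def by (intro sum.cong refl) (simp add: coef_eval_fps_upto[OF a])
  also have "\<dots> = (\<Sum>k\<le>m. fps_nth F k *\<^sub>R (\<Sum>w\<in>words_upto m. coef (a ^ k) w *\<^sub>R word_prod \<beta> w))"
    by (simp add: scaleR_sum_left scaleR_sum_right sum.swap[of _ "words_upto m"])
  also have "\<dots> = (\<Sum>k\<le>m. fps_nth F k *\<^sub>R eval_series \<beta> m (a ^ k))"
    by (simp add: eval_series_def)
  also have "\<dots> = fps_eval_upto m (eval_series \<beta> m a) F"
    by (simp add: fps_eval_upto_def eval_series_power[OF nil])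
  finally show ?thesis .
qed

lemma eval_series_cong: "(\<And>v. length v \<le> m \<Longrightarrow> coef f v = coef g v) \<Longrightarrow> eval_series \<beta> m f = eval_series \<beta> m g"
  by (simp add: eval_series_def)

lemma eval_series_commutator_word: "nilpotent_letters \<beta> m \<Longrightarrow> m \<ge> 1 \<Longrightarrow> eval_series \<beta> m (commutator_word letter w) = commutator_word \<beta> w"
  by (induct w rule: induct_list012) (simp_all add: eval_series_0 eval_series_letter eval_series_diff eval_series_mult)

lemma eval_series_sum: "finite A \<Longrightarrow> eval_series \<beta> m (sum f A) = (\<Sum>x\<in>A. eval_series \<beta> m (f x))"
  by (induct A rule: finite_induct) (simp_all add: eval_series_0 eval_series_add)

lemma eval_series_bch_series:
  assumes nil: "nilpotent_letters \<beta> m" and m: "m \<ge> 1"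
  shows "eval_series \<beta> m bch_series = (\<Sum>w\<in>words_upto m. (coef bch_series w / real (length w)) *\<^sub>R commutator_word \<beta> w)"
proof -
  have "eval_series \<beta> m bch_series = eval_series \<beta> m (\<Sum>w\<in>words_upto m. (coef bch_series w / real (length w)) *\<^sub>R commutator_word letter w)"
    by (rule eval_series_cong) (simp add: coef_sum coef_bch_series_eq_sum_commutator_word)
  also have "\<dots> = (\<Sum>w\<in>words_upto m. (coef bch_series w / real (length w)) *\<^sub>R eval_series \<beta> m (commutator_word letter w))"
    by (simp add: eval_series_sum eval_series_scaleR)
  also have "\<dots> = (\<Sum>w\<in>words_upto m. (coef bch_series w / real (length w)) *\<^sub>R commutator_word \<beta> w)"
    by (simp add: eval_series_commutator_word[OF nil m])
  finally show ?thesis .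
qed

definition exp_upto :: "nat \<Rightarrow> 'A::real_algebra_1 \<Rightarrow> 'A" where
  "exp_upto m A = fps_eval_upto m A (fps_exp 1)"

lemma eval_series_series_exp: "nilpotent_letters \<beta> m \<Longrightarrow> vanishes_below a 1 \<Longrightarrow> eval_series \<beta> m (series_exp a) = exp_upto m (eval_series \<beta> m a)"
  by (simp add: series_exp_def exp_upto_def eval_series_eval_fps)

lemma exp_upto_eval_series_bch_series:
  assumes nil: "nilpotent_letters \<beta> m" and m: "m \<ge> 1"
  shows "exp_upto m (eval_series \<beta> m bch_series) = exp_upto m (\<beta> True) * exp_upto m (\<beta> False)"
proof -
  have "exp_upto m (eval_series \<beta> m bch_series) = eval_series \<beta> m (series_exp bch_series)"
    by (simp add: eval_series_series_exp[OF nil vanishes_below_bch_series])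
  also have "\<dots> = eval_series \<beta> m exp_product" by (simp add: series_exp_bch_series)
  also have "\<dots> = exp_upto m (\<beta> True) * exp_upto m (\<beta> False)"
    by (simp add: exp_product_def eval_series_mult[OF nil] eval_series_series_exp[OF nil vanishes_below_letter] eval_series_letter[OF m])
  finally show ?thesis .
qed

lemma log1p_exp_upto:
  assumes nil: "nilpotent_letters \<beta> m" and m: "m \<ge> 1"
  shows "\<beta> True = fps_eval_upto m (exp_upto m (\<beta> True) - 1) (fps_ln 1)"
proof -
  have "\<beta> True = eval_series \<beta> m (series_log1p (series_exp (letter True) - 1))"
    by (simp add: series_log1p_exp[OF vanishes_below_letter] eval_series_letter[OF m])
  also have "\<dots> = fps_eval_upto m (eval_series \<beta> m (series_exp (letter True) - 1)) (fps_ln 1)"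
    by (simp add: series_log1p_def eval_series_eval_fps[OF nil vanishes_below_series_exp_minus_1])
  also have "\<dots> = fps_eval_upto m (exp_upto m (\<beta> True) - 1) (fps_ln 1)"
    by (simp add: eval_series_diff eval_series_1 eval_series_series_exp[OF nil vanishes_below_letter] eval_series_letter[OF m])
  finally show ?thesis .
qed

lemma exp_upto_scaleR_add:
  assumes nil: "nilpotent_letters \<beta> m" and m: "m \<ge> 1"
  shows "exp_upto m (c *\<^sub>R \<beta> True) * exp_upto m (d *\<^sub>R \<beta> True) = exp_upto m ((c + d) *\<^sub>R \<beta> True)"
proof -
  have o: "vanishes_below (c *\<^sub>R letter True) 1" for c
    using vanishes_below_scaleR[OF vanishes_below_letter] by blast
  have comm: "(c *\<^sub>R letter True) * (d *\<^sub>R letter True) = (d *\<^sub>R letter True) * (c *\<^sub>R letter True)"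
    by (simp add: mult.commute)
  have "series_exp (c *\<^sub>R letter True) * series_exp (d *\<^sub>R letter True) = series_exp ((c + d) *\<^sub>R letter True)"
    using series_exp_add_commuting[OF o o comm] by (simp add: scaleR_add_left)
  then have "eval_series \<beta> m (series_exp (c *\<^sub>R letter True) * series_exp (d *\<^sub>R letter True)) = eval_series \<beta> m (series_exp ((c + d) *\<^sub>R letter True))"
    by simp
  then show ?thesis
    by (simp add: eval_series_mult[OF nil] eval_series_series_exp[OF nil o] eval_series_scaleR eval_series_letter[OF m])
qed

lemma fps_eval_upto_0: "fps_eval_upto m (0::'A::real_algebra_1) F = fps_nth F 0 *\<^sub>R 1"
proof -
  have "fps_eval_upto m (0::'A) F = (\<Sum>k\<le>m. if k = 0 then fps_nth F 0 *\<^sub>R 1 else 0)"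
    unfolding fps_eval_upto_def by (intro sum.cong refl) (auto simp: power_0_left)
  then show ?thesis by simp
qed

lemma exp_upto_0: "exp_upto m (0::'A::real_algebra_1) = 1"
  by (simp add: exp_upto_def fps_eval_upto_0)

section \<open>The grading of a stratified Lie algebra\<close>

definition filtration :: "('n::finite \<Rightarrow> nat) \<Rightarrow> nat \<Rightarrow> (real^'n) set" where
  "filtration \<sigma> l = {x. \<forall>i. \<sigma> i < l \<longrightarrow> x $ i = 0}"

lemma vec_eq_sum_axis: "x = (\<Sum>i\<in>UNIV. x $ i *\<^sub>R axis i (1::real))"
  using basis_expansion[of x] by (simp add: scalar_mult_eq_scaleR)

lemma subspace_stratum: "subspace (stratum \<sigma> k)"
  unfolding stratum_def by (rule subspace_span)

lemma stratum_eq: "stratum \<sigma> k = {x. \<forall>i. \<sigma> i \<noteq> k \<longrightarrow> x $ i = 0}"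
proof
  show "stratum \<sigma> k \<subseteq> {x. \<forall>i. \<sigma> i \<noteq> k \<longrightarrow> x $ i = 0}"
    unfolding stratum_def
    by (rule span_minimal) (auto simp: axis_def intro!: real_vector.subspaceI)
next
  show "{x. \<forall>i. \<sigma> i \<noteq> k \<longrightarrow> x $ i = 0} \<subseteq> stratum \<sigma> k"
  proof
    fix x assume x: "x \<in> {x. \<forall>i. \<sigma> i \<noteq> k \<longrightarrow> x $ i = (0::real)}"
    have "x = (\<Sum>i\<in>UNIV. x $ i *\<^sub>R axis i (1::real))" by (rule vec_eq_sum_axis)
    also have "\<dots> = (\<Sum>i\<in>{i. \<sigma> i = k}. x $ i *\<^sub>R axis i (1::real))"
      by (rule sum.mono_neutral_right) (use x in auto)
    also have "\<dots> \<in> stratum \<sigma> k"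
      unfolding stratum_def by (intro span_sum span_scale span_base) auto
    finally show "x \<in> stratum \<sigma> k" .
  qed
qed

lemma axis_in_stratum: "axis i (1::real) \<in> stratum \<sigma> (\<sigma> i)"
  by (auto simp: stratum_def intro!: span_base)

locale carnot =
  fixes br :: "real^'n::finite \<Rightarrow> real^'n \<Rightarrow> real^'n" and \<sigma> :: "'n \<Rightarrow> nat"
  assumes SL: "stratified_lie_algebra br \<sigma>"
begin

lemma bilinear_br: "bilinear br" using SL by (simp add: stratified_lie_algebra_def)
lemma br_self: "br x x = 0" using SL by (simp add: stratified_lie_algebra_def)
lemma br_jacobi: "br x (br y z) + br y (br z x) + br z (br x y) = 0"
  using SL by (simp add: stratified_lie_algebra_def)
lemma sigma_ge_1: "1 \<le> \<sigma> i" using SL by (simp add: stratified_lie_algebra_def)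
lemma span_br_stratum: "k \<ge> 1 \<Longrightarrow> span {br u v | u v. u \<in> stratum \<sigma> 1 \<and> v \<in> stratum \<sigma> k} = stratum \<sigma> (k + 1)"
  using SL by (simp add: stratified_lie_algebra_def)

lemma br_add_left: "br (x + y) z = br x z + br y z" by (rule bilinear_ladd[OF bilinear_br])
lemma br_add_right: "br x (y + z) = br x y + br x z" by (rule bilinear_radd[OF bilinear_br])
lemma br_scaleR_left: "br (c *\<^sub>R x) y = c *\<^sub>R br x y" by (rule bilinear_lmul[OF bilinear_br])
lemma br_scaleR_right: "br x (c *\<^sub>R y) = c *\<^sub>R br x y" by (rule bilinear_rmul[OF bilinear_br])
lemma br_zero_left: "br 0 y = 0" by (rule bilinear_lzero[OF bilinear_br])
lemma br_zero_right: "br x 0 = 0" by (rule bilinear_rzero[OF bilinear_br])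
lemma br_diff_right: "br x (y - z) = br x y - br x z" by (rule bilinear_rsub[OF bilinear_br])
lemma br_minus_right: "br x (- y) = - br x y" by (rule bilinear_rneg[OF bilinear_br])

lemma br_antisym: "br x y = - br y x"
proof -
  have h: "br (x + y) (x + y) = br x x + br x y + br y x + br y y"
    by (simp add: br_add_left br_add_right algebra_simps)
  have "br x y + br y x = br (x + y) (x + y) - br x x - br y y" using h by (simp add: algebra_simps)
  then have "br x y + br y x = 0" by (simp add: br_self)
  then show ?thesis by (simp add: eq_neg_iff_add_eq_0)
qed

lemma br_jacobi_commutator: "br X (br Y z) - br Y (br X z) = br (br X Y) z"
proof -
  have "br X (br Y z) + br Y (br z X) + br z (br X Y) = 0" by (rule br_jacobi)
  then show ?thesis
    by (simp add: br_antisym[of z X] br_antisym[of z "br X Y"] br_minus_right algebra_simps)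
qed

lemma subspace_br_left_into: "subspace W \<Longrightarrow> subspace {u. \<forall>v\<in>V. br u v \<in> W}"
  by (rule real_vector.subspaceI)
     (auto simp: br_zero_left br_add_left br_scaleR_left real_vector.subspace_0
        real_vector.subspace_add real_vector.subspace_scale)

lemma br_stratum_1: "k \<ge> 1 \<Longrightarrow> u \<in> stratum \<sigma> 1 \<Longrightarrow> v \<in> stratum \<sigma> k \<Longrightarrow> br u v \<in> stratum \<sigma> (k + 1)"
proof -
  assume k: "k \<ge> 1" and "u \<in> stratum \<sigma> 1" "v \<in> stratum \<sigma> k"
  then have "br u v \<in> span {br u v | u v. u \<in> stratum \<sigma> 1 \<and> v \<in> stratum \<sigma> k}"
    by (intro span_base) blast
  then show ?thesis
    using span_br_stratum[OF k] by simp
qed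

lemma br_stratum:
  "a \<ge> 1 \<Longrightarrow> b \<ge> 1 \<Longrightarrow> u \<in> stratum \<sigma> a \<Longrightarrow> v \<in> stratum \<sigma> b \<Longrightarrow> br u v \<in> stratum \<sigma> (a + b)"
proof (induct a arbitrary: b u v rule: nat_induct_at_least)
  case base
  then show ?case using br_stratum_1[of b u v] by (simp add: add.commute)
next
  case (Suc a)
  let ?W = "{u. \<forall>v\<in>stratum \<sigma> b. br u v \<in> stratum \<sigma> (Suc a + b)}"
  have "{br u1 ua | u1 ua. u1 \<in> stratum \<sigma> 1 \<and> ua \<in> stratum \<sigma> a} \<subseteq> ?W"
  proof clarify
    fix u1 ua v assume u1: "u1 \<in> stratum \<sigma> 1" and ua: "ua \<in> stratum \<sigma> a" and v: "v \<in> stratum \<sigma> b"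
    have "br u1 (br ua v) \<in> stratum \<sigma> (Suc a + b)"
      using br_stratum_1[OF _ u1 Suc.hyps(2)[OF Suc.prems(1) ua v]] Suc.hyps(1) by simp
    moreover have "br ua (br u1 v) \<in> stratum \<sigma> (Suc a + b)"
      using Suc.hyps(2)[OF _ ua br_stratum_1[OF Suc.prems(1) u1 v]] by simp
    ultimately show "br (br u1 ua) v \<in> stratum \<sigma> (Suc a + b)"
      by (metis br_jacobi_commutator subspace_stratum real_vector.subspace_diff)
  qed
  then have "span {br u1 ua | u1 ua. u1 \<in> stratum \<sigma> 1 \<and> ua \<in> stratum \<sigma> a} \<subseteq> ?W"
    by (rule span_minimal) (rule subspace_br_left_into[OF subspace_stratum])
  then have "stratum \<sigma> (Suc a) \<subseteq> ?W"
    using span_br_stratum[OF Suc.hyps(1)] by simp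
  then show ?case
    using Suc.prems by blast
qed

lemma br_axis_component_nonzero: "(br (axis i 1) (axis j 1)) $ k \<noteq> 0 \<Longrightarrow> \<sigma> k = \<sigma> i + \<sigma> j"
  using br_stratum[OF sigma_ge_1 sigma_ge_1 axis_in_stratum axis_in_stratum, of i j]
  by (auto simp: stratum_eq)

lemma br_sum_left: "finite A \<Longrightarrow> br (sum f A) y = (\<Sum>i\<in>A. br (f i) y)"
  by (induct A rule: finite_induct) (simp_all add: br_zero_left br_add_left)
lemma br_sum_right: "finite A \<Longrightarrow> br x (sum f A) = (\<Sum>i\<in>A. br x (f i))"
  by (induct A rule: finite_induct) (simp_all add: br_zero_right br_add_right)

lemma br_eq_sum_axis: "br u v = (\<Sum>i\<in>UNIV. \<Sum>j\<in>UNIV. (u $ i * v $ j) *\<^sub>R br (axis i 1) (axis j 1))"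
proof -
  have "br u v = br (\<Sum>i\<in>UNIV. u $ i *\<^sub>R axis i (1::real)) (\<Sum>j\<in>UNIV. v $ j *\<^sub>R axis j (1::real))"
    using vec_eq_sum_axis[of u] vec_eq_sum_axis[of v] by simp
  also have "\<dots> = (\<Sum>i\<in>UNIV. \<Sum>j\<in>UNIV. (u $ i * v $ j) *\<^sub>R br (axis i 1) (axis j 1))"
    apply (simp add: br_sum_left br_sum_right br_scaleR_left br_scaleR_right scaleR_sum_right)
    apply (subst sum.swap)
    apply (simp add: mult.commute)
    done
  finally show ?thesis .
qed

lemma br_component: "(br u v) $ k = (\<Sum>i\<in>UNIV. \<Sum>j\<in>UNIV. u $ i * v $ j * (br (axis i 1) (axis j 1)) $ k)"
  by (subst br_eq_sum_axis) (simp add: sum_component)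

lemma br_filtration: "v \<in> filtration \<sigma> l \<Longrightarrow> br u v \<in> filtration \<sigma> (l + 1)"
proof -
  assume v: "v \<in> filtration \<sigma> l"
  have "(br u v) $ k = 0" if k: "\<sigma> k < l + 1" for k
  proof -
    have "u $ i * v $ j * (br (axis i 1) (axis j 1)) $ k = 0" for i j
    proof (cases "(br (axis i 1) (axis j 1)) $ k = 0")
      case False
      then have "\<sigma> k = \<sigma> i + \<sigma> j" by (rule br_axis_component_nonzero)
      then have "\<sigma> j < l" using k sigma_ge_1[of i] by simp
      then have "v $ j = 0" using v by (simp add: filtration_def)
      then show ?thesis by simp
    qed simp
    then show ?thesis by (subst br_component) (simp add: sum.neutral)
  qed
  then show ?thesis by (simp add: filtration_def)
qed

abbreviation step :: nat where "step \<equiv> carnot_step \<sigma>"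

lemma sigma_le_step: "\<sigma> i \<le> step"
  unfolding carnot_step_def by (rule Max_ge) auto

lemma step_ge_1: "step \<ge> 1" using sigma_le_step[of undefined] sigma_ge_1[of undefined] by simp

lemma filtration_beyond_step: "l > step \<Longrightarrow> x \<in> filtration \<sigma> l \<Longrightarrow> x = 0"
  using sigma_le_step by (auto simp: filtration_def vec_eq_iff intro: le_less_trans)

lemma filtration_1: "x \<in> filtration \<sigma> 1"
  using sigma_ge_1 by (auto simp: filtration_def not_less_eq_eq dest: leD)

lemma nested_bracket_filtration: "w \<noteq> [] \<Longrightarrow> nested_bracket br X Y w \<in> filtration \<sigma> (length w)"
proof (induct w rule: induct_list012)
  case (2 a) then show ?case using filtration_1[of X] filtration_1[of Y] by simp
next
  case (3 a b w)
  then show ?case using br_filtration[of "nested_bracket br X Y (b # w)" "length (b # w)"] by simp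
qed simp

end

definition grading_derivation :: "('n::finite \<Rightarrow> nat) \<Rightarrow> real^'n \<Rightarrow> real^'n" where
  "grading_derivation \<sigma> x = (\<chi> i. real (\<sigma> i) * x $ i)"

context carnot
begin

lemma grading_derivation_br: "grading_derivation \<sigma> (br u v) = br (grading_derivation \<sigma> u) v + br u (grading_derivation \<sigma> v)"
unfolding vec_eq_iff proof (intro allI)
  fix k
  have t: "real (\<sigma> k) * (u $ i * v $ j * (br (axis i 1) (axis j 1)) $ k) =
        real (\<sigma> i) * u $ i * v $ j * (br (axis i 1) (axis j 1)) $ k +
        u $ i * (real (\<sigma> j) * v $ j) * (br (axis i 1) (axis j 1)) $ k" for i j
  proof (cases "(br (axis i 1) (axis j 1)) $ k = 0")
    case False
    then have "\<sigma> k = \<sigma> i + \<sigma> j" by (rule br_axis_component_nonzero)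
    then show ?thesis by (simp add: algebra_simps)
  qed simp
  have "(grading_derivation \<sigma> (br u v)) $ k = (\<Sum>i\<in>UNIV. \<Sum>j\<in>UNIV. real (\<sigma> k) * (u $ i * v $ j * (br (axis i 1) (axis j 1)) $ k))"
    by (simp add: grading_derivation_def br_component[of u v k] sum_distrib_left)
  also have "\<dots> = (\<Sum>i\<in>UNIV. \<Sum>j\<in>UNIV. real (\<sigma> i) * u $ i * v $ j * (br (axis i 1) (axis j 1)) $ k) +
       (\<Sum>i\<in>UNIV. \<Sum>j\<in>UNIV. u $ i * (real (\<sigma> j) * v $ j) * (br (axis i 1) (axis j 1)) $ k)"
    by (simp only: t sum.distrib)
  also have "\<dots> = (br (grading_derivation \<sigma> u) v + br u (grading_derivation \<sigma> v)) $ k"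
    by (simp only: vector_add_component br_component[of "grading_derivation \<sigma> u" v k] br_component[of u "grading_derivation \<sigma> v" k])
       (simp add: grading_derivation_def)
  finally show "(grading_derivation \<sigma> (br u v)) $ k = (br (grading_derivation \<sigma> u) v + br u (grading_derivation \<sigma> v)) $ k" .
qed

lemma dil_br: "dil \<sigma> r (br u v) = br (dil \<sigma> r u) (dil \<sigma> r v)"
unfolding vec_eq_iff proof (intro allI)
  fix k
  have t: "r ^ \<sigma> k * (u $ i * v $ j * (br (axis i 1) (axis j 1)) $ k) =
        (r ^ \<sigma> i * u $ i) * (r ^ \<sigma> j * v $ j) * (br (axis i 1) (axis j 1)) $ k" for i j
  proof (cases "(br (axis i 1) (axis j 1)) $ k = 0")
    case False
    then have "\<sigma> k = \<sigma> i + \<sigma> j" by (rule br_axis_component_nonzero)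
    then show ?thesis by (simp add: algebra_simps power_add)
  qed simp
  have "(dil \<sigma> r (br u v)) $ k = (\<Sum>i\<in>UNIV. \<Sum>j\<in>UNIV. r ^ \<sigma> k * (u $ i * v $ j * (br (axis i 1) (axis j 1)) $ k))"
    by (simp add: dil_def br_component[of u v k] sum_distrib_left)
  also have "\<dots> = (\<Sum>i\<in>UNIV. \<Sum>j\<in>UNIV. (r ^ \<sigma> i * u $ i) * (r ^ \<sigma> j * v $ j) * (br (axis i 1) (axis j 1)) $ k)"
    by (simp only: t)
  also have "\<dots> = (br (dil \<sigma> r u) (dil \<sigma> r v)) $ k"
    by (simp only: br_component[of "dil \<sigma> r u" "dil \<sigma> r v" k]) (simp add: dil_def)
  finally show "(dil \<sigma> r (br u v)) $ k = (br (dil \<sigma> r u) (dil \<sigma> r v)) $ k" .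
qed

lemma dil_add: "dil \<sigma> r (x + y) = dil \<sigma> r x + dil \<sigma> r y"
  by (simp add: dil_def vec_eq_iff algebra_simps)
lemma dil_scaleR: "dil \<sigma> r (c *\<^sub>R x) = c *\<^sub>R dil \<sigma> r x"
  by (simp add: dil_def vec_eq_iff algebra_simps)
lemma dil_zero: "dil \<sigma> r 0 = 0"
  by (simp add: dil_def vec_eq_iff)
lemma dil_sum: "finite A \<Longrightarrow> dil \<sigma> r (sum f A) = (\<Sum>i\<in>A. dil \<sigma> r (f i))"
  by (induct A rule: finite_induct) (simp_all add: dil_zero dil_add)

lemma nested_bracket_dil: "nested_bracket br (dil \<sigma> r X) (dil \<sigma> r Y) w = dil \<sigma> r (nested_bracket br X Y w)"
  by (induct w rule: induct_list012) (auto simp: dil_zero dil_br)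

end

section \<open>A faithful nilpotent representation\<close>

typedef (overloaded) ('n::finite) endo = "{f :: (real^'n) \<times> real \<Rightarrow> (real^'n) \<times> real. linear f}"
  morphisms app Abs_endo
  by (rule exI[of _ "\<lambda>x. x"]) (simp add: linear_iff)

setup_lifting type_definition_endo

instantiation endo :: (finite) real_algebra_1
begin
lift_definition zero_endo :: "'a::finite endo" is "\<lambda>_. 0" by (simp add: linear_iff)
lift_definition one_endo :: "'a::finite endo" is "\<lambda>x. x" by (simp add: linear_iff)
lift_definition plus_endo :: "'a::finite endo \<Rightarrow> 'a endo \<Rightarrow> 'a endo" is "\<lambda>f g x. f x + g x"
  by (simp add: linear_iff algebra_simps scaleR_add_right)
lift_definition minus_endo :: "'a::finite endo \<Rightarrow> 'a endo \<Rightarrow> 'a endo" is "\<lambda>f g x. f x - g x"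
  by (simp add: linear_iff algebra_simps scaleR_diff_right)
lift_definition uminus_endo :: "'a::finite endo \<Rightarrow> 'a endo" is "\<lambda>f x. - f x"
  by (simp add: linear_iff algebra_simps)
lift_definition scaleR_endo :: "real \<Rightarrow> 'a::finite endo \<Rightarrow> 'a endo" is "\<lambda>c f x. c *\<^sub>R f x"
  by (simp add: linear_iff algebra_simps scaleR_add_right)
lift_definition times_endo :: "'a::finite endo \<Rightarrow> 'a endo \<Rightarrow> 'a endo" is "\<lambda>f g x. f (g x)"
  using linear_compose[unfolded o_def] by blast
instance
proof
  fix a b c :: "'a endo" and r s :: real
  show "a * b * c = a * (b * c)" by transfer simp
  show "1 * a = a" by transfer simp
  show "a * 1 = a" by transfer simp
  show "(a + b) * c = a * c + b * c" by transfer simp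
  show "a * (b + c) = a * b + a * c" by transfer (simp add: real_vector.linear_add)
  show "(0::'a::finite endo) \<noteq> 1"
  proof transfer
    show "(\<lambda>_. 0::(real^'a) \<times> real) \<noteq> (\<lambda>x. x)"
    proof
      assume "(\<lambda>_. 0::(real^'a) \<times> real) = (\<lambda>x. x)"
      then have "(0::(real^'a) \<times> real) = (0, 1)" by metis
      then show False by (simp add: zero_prod_def)
    qed
  qed
  show "a + b + c = a + (b + c)" by transfer (simp add: add.assoc)
  show "a + b = b + a" by transfer (simp add: add.commute)
  show "0 + a = a" by transfer simp
  show "- a + a = 0" by transfer simp
  show "a - b = a + - b" by transfer simp
  show "r *\<^sub>R (a + b) = r *\<^sub>R a + r *\<^sub>R b" by transfer (simp add: scaleR_add_right)
  show "(r + s) *\<^sub>R a = r *\<^sub>R a + s *\<^sub>R a" by transfer (simp add: scaleR_add_left)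
  show "r *\<^sub>R s *\<^sub>R a = (r * s) *\<^sub>R a" by transfer simp
  show "1 *\<^sub>R a = a" by transfer simp
  show "r *\<^sub>R a * b = r *\<^sub>R (a * b)" by transfer simp
  show "a * r *\<^sub>R b = r *\<^sub>R (a * b)" by transfer (simp add: real_vector.linear_scale)
qed
end

lemma endo_eqI: "(\<And>x. app A x = app B x) \<Longrightarrow> A = B"
  by (metis app_inject ext)

lemma app_simps [simp]:
  "app 0 x = 0" "app 1 x = x" "app (A + B) x = app A x + app B x" "app (A - B) x = app A x - app B x"
  "app (- A) x = - app A x" "app (c *\<^sub>R A) x = c *\<^sub>R app A x" "app (A * B) x = app A (app B x)"
  by (transfer, simp)+

context carnot
begin

text \<open>The adjoint representation extended by the grading derivation \<open>D\<close>.  It is still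
  nilpotent, since it raises the degree filtration, and it is faithful, because
  \<open>rep X (0, 1) = (- D X, 0)\<close> and \<open>D\<close> is invertible as all degrees are positive.\<close>

definition rep :: "real^'n \<Rightarrow> 'n endo" where
  "rep X = Abs_endo (\<lambda>p. (br X (fst p) - snd p *\<^sub>R grading_derivation \<sigma> X, 0))"

lemma app_rep: "app (rep X) p = (br X (fst p) - snd p *\<^sub>R grading_derivation \<sigma> X, 0)"
proof -
  have lin: "linear (\<lambda>p::(real^'n) \<times> real. (br X (fst p) - snd p *\<^sub>R grading_derivation \<sigma> X, 0))"
    by (simp add: linear_iff br_add_right br_scaleR_right algebra_simps scaleR_add_left scaleR_diff_right)
  have "app (Abs_endo (\<lambda>p::(real^'n) \<times> real. (br X (fst p) - snd p *\<^sub>R grading_derivation \<sigma> X, 0))) =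
     (\<lambda>p. (br X (fst p) - snd p *\<^sub>R grading_derivation \<sigma> X, 0))" by (rule Abs_endo_inverse) (simp add: lin)
  then show ?thesis by (simp add: rep_def)
qed

lemma rep_br: "rep (br X Y) = rep X * rep Y - rep Y * rep X"
proof (rule endo_eqI)
  fix p :: "(real^'n) \<times> real"
  have d: "grading_derivation \<sigma> (br X Y) = br X (grading_derivation \<sigma> Y) - br Y (grading_derivation \<sigma> X)"
    by (simp add: grading_derivation_br br_antisym[of "grading_derivation \<sigma> X" Y])
  show "app (rep (br X Y)) p = app (rep X * rep Y - rep Y * rep X) p"
    by (simp add: app_rep br_diff_right br_scaleR_right d br_jacobi_commutator[symmetric, of X Y "fst p"] algebra_simps)
qed

lemma rep_add: "rep (X + Y) = rep X + rep Y"
  by (rule endo_eqI) (simp add: app_rep br_add_left grading_derivation_def vec_eq_iff algebra_simps)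

lemma rep_scaleR: "rep (c *\<^sub>R X) = c *\<^sub>R rep X"
  by (rule endo_eqI) (simp add: app_rep br_scaleR_left grading_derivation_def vec_eq_iff algebra_simps)

lemma rep_zero: "rep 0 = 0"
  by (rule endo_eqI) (simp add: app_rep br_zero_left grading_derivation_def vec_eq_iff zero_prod_def)

lemma rep_sum: "finite A \<Longrightarrow> rep (sum f A) = (\<Sum>i\<in>A. rep (f i))"
  by (induct A rule: finite_induct) (simp_all add: rep_zero rep_add)

lemma rep_inj: "rep X = rep Y \<Longrightarrow> X = Y"
proof -
  assume "rep X = rep Y"
  then have "app (rep X) (0, 1) = app (rep Y) (0, 1)" by simp
  then have "grading_derivation \<sigma> X = grading_derivation \<sigma> Y" by (simp add: app_rep br_zero_right)
  then have "real (\<sigma> i) * X $ i = real (\<sigma> i) * Y $ i" for i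
    by (simp add: grading_derivation_def vec_eq_iff)
  moreover have "real (\<sigma> i) \<noteq> 0" for i using sigma_ge_1[of i] by simp
  ultimately have "X $ i = Y $ i" for i by (metis mult_cancel_left)
  then show "X = Y" by (simp add: vec_eq_iff)
qed

definition rep_filtration :: "nat \<Rightarrow> ((real^'n) \<times> real) set" where
  "rep_filtration l = {p. (l \<ge> 1 \<longrightarrow> snd p = 0) \<and> fst p \<in> filtration \<sigma> l}"

lemma app_rep_filtration: "p \<in> rep_filtration l \<Longrightarrow> app (rep X) p \<in> rep_filtration (Suc l)"
proof -
  assume p: "p \<in> rep_filtration l"
  show ?thesis
  proof (cases "l = 0")
    case True
    then show ?thesis using filtration_1 by (simp add: rep_filtration_def app_rep)
  next
    case False
    then have "snd p = 0" "fst p \<in> filtration \<sigma> l" using p by (auto simp: rep_filtration_def)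
    then show ?thesis using br_filtration[of "fst p" l X] by (simp add: rep_filtration_def app_rep)
  qed
qed

lemma app_word_prod_filtration: "(\<And>a. \<beta> a \<in> range rep) \<Longrightarrow> app (word_prod \<beta> w) p \<in> rep_filtration (length w)"
proof (induct w)
  case Nil then show ?case by (simp add: rep_filtration_def filtration_def)
next
  case (Cons a w)
  then obtain X where "\<beta> a = rep X" by blast
  then show ?case using app_rep_filtration[OF Cons.hyps[OF Cons.prems]] by simp
qed

lemma rep_filtration_beyond_step: "l > step \<Longrightarrow> p \<in> rep_filtration l \<Longrightarrow> p = 0"
  using filtration_beyond_step[of l "fst p"]
    by (cases p) (auto simp: rep_filtration_def zero_prod_def)

lemma nilpotent_letters_rep: "(\<And>a. \<beta> a \<in> range rep) \<Longrightarrow> nilpotent_letters \<beta> step"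
  unfolding nilpotent_letters_def
proof (intro allI impI)
  fix w :: "bool list" assume b: "\<And>a. \<beta> a \<in> range rep" and w: "step < length w"
  show "word_prod \<beta> w = 0"
    by (rule endo_eqI) (use rep_filtration_beyond_step[OF w app_word_prod_filtration[OF b]] in simp)
qed

end

section \<open>The group law and the projections\<close>

lemma exp_dir_0 [simp]: "exp_dir j 0 = 0"
  by (simp add: exp_dir_def)

lemma exp_dir_nth_same [simp]: "exp_dir j t $ j = t"
  by (simp add: exp_dir_def axis_def)

context carnot
begin

lemma nested_bracket_long: "length w > step \<Longrightarrow> nested_bracket br X Y w = 0"
  using nested_bracket_filtration[of w X Y] filtration_beyond_step[of "length w"]
    by (cases "w = []") auto

lemma carnot_mult_eq_sum: "carnot_mult br \<sigma> X Y = (\<Sum>w\<in>words_upto step. (coef bch_series w / real (length w)) *\<^sub>R nested_bracket br X Y w)"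
  unfolding carnot_mult_def bch_def
  by (rule bch_eq_sum_bch_series) (rule nested_bracket_long)

definition rep_letters :: "real^'n \<Rightarrow> real^'n \<Rightarrow> bool \<Rightarrow> 'n endo" where
  "rep_letters X Y = (\<lambda>a. if a then rep X else rep Y)"

lemma rep_letters_range: "rep_letters X Y a \<in> range rep" by (simp add: rep_letters_def)

lemma nilpotent_rep_letters: "nilpotent_letters (rep_letters X Y) step"
  by (rule nilpotent_letters_rep) (rule rep_letters_range)

lemma rep_nested_bracket: "rep (nested_bracket br X Y w) = commutator_word (rep_letters X Y) w"
  by (induct w rule: induct_list012) (simp_all add: rep_zero rep_br rep_letters_def)

lemma rep_carnot_mult: "rep (carnot_mult br \<sigma> X Y) = eval_series (rep_letters X Y) step bch_series"
  by (simp add: carnot_mult_eq_sum rep_sum rep_scaleR rep_nested_bracket eval_series_bch_series[OF nilpotent_rep_letters step_ge_1])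

lemma exp_rep_carnot_mult: "exp_upto step (rep (carnot_mult br \<sigma> X Y)) = exp_upto step (rep X) * exp_upto step (rep Y)"
  using exp_upto_eval_series_bch_series[OF nilpotent_rep_letters step_ge_1, of X Y]
    by (simp add: rep_carnot_mult rep_letters_def)

lemma exp_rep_inj: "exp_upto step (rep X) = exp_upto step (rep Y) \<Longrightarrow> X = Y"
proof -
  assume e: "exp_upto step (rep X) = exp_upto step (rep Y)"
  have n: "nilpotent_letters (\<lambda>_. rep Z) step" for Z by (rule nilpotent_letters_rep) simp
  have "rep X = fps_eval_upto step (exp_upto step (rep X) - 1) (fps_ln 1)"
    using log1p_exp_upto[OF n step_ge_1] by simp
  also have "\<dots> = fps_eval_upto step (exp_upto step (rep Y) - 1) (fps_ln 1)" by (simp add: e)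
  also have "\<dots> = rep Y" using log1p_exp_upto[OF n step_ge_1] by simp
  finally show "X = Y" by (rule rep_inj)
qed

lemma carnot_mult_assoc: "carnot_mult br \<sigma> (carnot_mult br \<sigma> X Y) Z = carnot_mult br \<sigma> X (carnot_mult br \<sigma> Y Z)"
  by (rule exp_rep_inj) (simp add: exp_rep_carnot_mult mult.assoc)

lemma carnot_mult_0_right: "carnot_mult br \<sigma> X 0 = X"
  by (rule exp_rep_inj) (simp add: exp_rep_carnot_mult rep_zero exp_upto_0)

lemma carnot_mult_scaleR_same: "carnot_mult br \<sigma> (c *\<^sub>R U) (d *\<^sub>R U) = (c + d) *\<^sub>R U"
proof (rule exp_rep_inj)
  have n: "nilpotent_letters (\<lambda>_. rep U) step" by (rule nilpotent_letters_rep) simp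
  show "exp_upto step (rep (carnot_mult br \<sigma> (c *\<^sub>R U) (d *\<^sub>R U))) = exp_upto step (rep ((c + d) *\<^sub>R U))"
    using exp_upto_scaleR_add[OF n step_ge_1, of c d] by (simp add: exp_rep_carnot_mult rep_scaleR)
qed

lemma carnot_mult_dil: "carnot_mult br \<sigma> (dil \<sigma> r X) (dil \<sigma> r Y) = dil \<sigma> r (carnot_mult br \<sigma> X Y)"
  by (simp add: carnot_mult_eq_sum nested_bracket_dil dil_sum dil_scaleR)

lemma coef_bch_series_letter: "coef bch_series [a] = 1"
proof -
  have "coef bch_series [a] = (\<Sum>k\<le>1. fps_nth (fps_ln 1) k * coef ((exp_product - 1) ^ k) [a])"
    by (simp add: bch_series_def series_log1p_def coef_eval_fps)
  also have "\<dots> = coef exp_product [a]" by (simp add: fps_ln_nth)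
  also have "\<dots> = 1"
  proof (cases a)
    case True
    then have "[a] = block_word 1 0" by (simp add: block_word_def)
    then show ?thesis by (simp add: coef_exp_product_block_word)
  next
    case False
    then have "[a] = block_word 0 1" by (simp add: block_word_def)
    then show ?thesis by (simp add: coef_exp_product_block_word)
  qed
  finally show ?thesis .
qed

lemma carnot_mult_component_first_stratum:
  assumes j: "\<sigma> j = 1"
  shows "(carnot_mult br \<sigma> X Y) $ j = X $ j + Y $ j"
proof -
  have long: "(nested_bracket br X Y w) $ j = 0" if "length w \<ge> 2" for w
  proof -
    have "nested_bracket br X Y w \<in> filtration \<sigma> (length w)"
      using that by (intro nested_bracket_filtration) auto
    then show ?thesis using that j by (auto simp: filtration_def)
  qed
  have "(carnot_mult br \<sigma> X Y) $ j =
      (\<Sum>w\<in>words_upto step. (coef bch_series w / real (length w)) * (nested_bracket br X Y w) $ j)"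
    by (simp add: carnot_mult_eq_sum sum_component)
  also have "\<dots> = (\<Sum>w\<in>{[True], [False]}. (coef bch_series w / real (length w)) * (nested_bracket br X Y w) $ j)"
  proof (rule sum.mono_neutral_right)
    show "{[True], [False]} \<subseteq> words_upto step"
      using step_ge_1 by auto
    show "\<forall>w\<in>words_upto step - {[True], [False]}.
        coef bch_series w / real (length w) * nested_bracket br X Y w $ j = 0"
    proof
      fix w assume "w \<in> words_upto step - {[True], [False]}"
      then have "w = [] \<or> 2 \<le> length w"
        by (cases w; cases "tl w") auto
      then show "coef bch_series w / real (length w) * nested_bracket br X Y w $ j = 0"
        using long by auto
    qed
  qed simp
  also have "\<dots> = X $ j + Y $ j"
    by (simp add: coef_bch_series_letter)
  finally show ?thesis .
qed

lemma carnot_mult_exp_dir: "carnot_mult br \<sigma> (exp_dir j s) (exp_dir j t) = exp_dir j (s + t)"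
  using carnot_mult_scaleR_same[of s "axis j 1" t] by (simp add: exp_dir_def)

lemma carnot_mult_exp_dir_cancel:
  "carnot_mult br \<sigma> (carnot_mult br \<sigma> q (exp_dir j t)) (exp_dir j (- t)) = q"
  by (simp add: carnot_mult_assoc carnot_mult_exp_dir carnot_mult_0_right)

lemma Pr_eq:
  assumes "\<sigma> j = 1"
  shows "Pr br \<sigma> j x = carnot_mult br \<sigma> x (exp_dir j (- x $ j))"
  unfolding Pr_def
proof (rule the_equality)
  let ?p = "carnot_mult br \<sigma> x (exp_dir j (- x $ j))"
  show "?p \<in> Pi_plane j \<and> x = carnot_mult br \<sigma> ?p (exp_dir j (x $ j))"
    using carnot_mult_exp_dir_cancel[where q = x and j = j and t = "- x $ j"]
    by (simp add: Pi_plane_def carnot_mult_component_first_stratum[OF assms])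
next
  fix q assume "q \<in> Pi_plane j \<and> x = carnot_mult br \<sigma> q (exp_dir j (x $ j))"
  then have "carnot_mult br \<sigma> x (exp_dir j (- x $ j)) =
      carnot_mult br \<sigma> (carnot_mult br \<sigma> q (exp_dir j (x $ j))) (exp_dir j (- x $ j))"
    by (metis (no_types))
  then show "q = carnot_mult br \<sigma> x (exp_dir j (- x $ j))"
    by (simp add: carnot_mult_exp_dir_cancel)
qed

lemma Pr_mult_exp_dir:
  assumes "\<sigma> j = 1"
  shows "carnot_mult br \<sigma> (Pr br \<sigma> j x) (exp_dir j (x $ j)) = x"
  using carnot_mult_exp_dir_cancel[where q = x and j = j and t = "- x $ j"]
    by (simp add: Pr_eq[OF assms])

lemma Pr_dil:
  assumes "\<sigma> j = 1"
  shows "Pr br \<sigma> j (dil \<sigma> r x) = dil \<sigma> r (Pr br \<sigma> j x)"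
proof -
  have "dil \<sigma> r (exp_dir j t) = exp_dir j (r * t)" for t
    by (simp add: dil_def exp_dir_def vec_eq_iff axis_def assms)
  moreover have "(dil \<sigma> r x) $ j = r * x $ j"
    by (simp add: dil_def assms)
  ultimately show ?thesis
    by (simp add: Pr_eq[OF assms] flip: carnot_mult_dil)
qed

lemma Pr_carnot_mult:
  assumes "\<sigma> j = 1"
  shows "Pr br \<sigma> j (carnot_mult br \<sigma> x y) =
    carnot_mult br \<sigma> (carnot_mult br \<sigma> (carnot_mult br \<sigma> (Pr br \<sigma> j x) (exp_dir j (x $ j))) (Pr br \<sigma> j y))
      (exp_dir j (- (x $ j)))"
proof -
  have "carnot_mult br \<sigma> (carnot_mult br \<sigma> (carnot_mult br \<sigma> (Pr br \<sigma> j x) (exp_dir j (x $ j))) (Pr br \<sigma> j y))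
      (exp_dir j (- (x $ j)))
    = carnot_mult br \<sigma> (carnot_mult br \<sigma> x y) (carnot_mult br \<sigma> (exp_dir j (- y $ j)) (exp_dir j (- x $ j)))"
    by (simp add: Pr_mult_exp_dir[OF assms] Pr_eq[OF assms, of y] carnot_mult_assoc)
  also have "\<dots> = carnot_mult br \<sigma> (carnot_mult br \<sigma> x y) (exp_dir j (- (carnot_mult br \<sigma> x y) $ j))"
    by (simp add: carnot_mult_exp_dir carnot_mult_component_first_stratum[OF assms] add.commute)
  finally show ?thesis
    by (simp add: Pr_eq[OF assms])
qed

end

theorem mainTheorem13:
  fixes br :: "real^'n \<Rightarrow> real^'n \<Rightarrow> real^'n"
    and \<sigma> :: "'n::finite \<Rightarrow> nat"
    and j :: 'n
  assumes "stratified_lie_algebra br \<sigma>"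
    and "\<sigma> j = 1"
  shows "(\<forall>x (r::real). r > 0 \<longrightarrow> Pr br \<sigma> j (dil \<sigma> r x) = dil \<sigma> r (Pr br \<sigma> j x))
       \<and> (\<forall>x y. Pr br \<sigma> j (carnot_mult br \<sigma> x y) =
            carnot_mult br \<sigma>
              (carnot_mult br \<sigma>
                 (carnot_mult br \<sigma> (Pr br \<sigma> j x) (exp_dir j (x $ j)))
                 (Pr br \<sigma> j y))
              (exp_dir j (- (x $ j))))"
proof -
  interpret carnot br \<sigma>
    by (rule carnot.intro) (rule assms(1))
  show ?thesis
    using Pr_dil[OF assms(2)] Pr_carnot_mult[OF assms(2)] by blast
qed

end
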